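(* Let $\mathcal{H}$, $\mathcal{K}$ be Hilbert spaces and let $A_{(\alpha)}\in B(\mathcal{K})$, $\alpha\in\mathbb{F}_n^+$, be a sequence of operators. Define $R\in[0,\infty]$ by setting $$\frac1R:=\limsup_{k\to\infty}\Big\|\sum_{|\alpha|=k}A_{(\alpha)}^*A_{(\alpha)}\Big\|^{\frac1{2k}}.$$ Then the following properties hold. (i) For any $n$-tuple of operators $[X_1,\ldots,X_n]\in B(\mathcal{H})^n$, the series $\sum_{k=0}^\infty\big\|\sum_{|\alpha|=k}A_{(\alpha)}\otimes X_\alpha\big\|$ converges if $\|[X_1,\ldots,X_n]\|<R$. Moreover, if $0\le\rho<R$, then the convergence is uniform for $[X_1,\ldots,X_n]$ with $\|[X_1,\ldots,X_n]\|\le\rho$. (ii) If $R<R'<\infty$ and $\mathcal{H}$ is infinite dimensional, then there is an $n$-tuple $[X_1,\ldots,X_n]\in B(\mathcal{H})^n$ of operators with $\|X_1X_1^*+\cdots+X_nX_n^*\|^{1/2}=R'$ such that the series $\sum_{k=0}^\infty\big(\sum_{|\alpha|=k}A_{(\alpha)}\otimes X_\alpha\big)$ is divergent in the operator norm of $B(\mathcal{K}\otimes\mathcal{H})$. Moreover, the number $R$ satisfying properties (i) and (ii) is unique.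
   Context: $\mathbb{F}_n^+$ is the unital free semigroup on $n$ generators $g_1,\ldots,g_n$ with identity $g_0$; $|\alpha|$ is the length of the word $\alpha$ ($|g_0|=0$). For operators $X_1,\ldots,X_n$ on $\mathcal{H}$ and $\alpha=g_{i_1}\cdots g_{i_k}$, $X_\alpha:=X_{i_1}\cdots X_{i_k}$ and $X_{g_0}:=I$. $\|[X_1,\ldots,X_n]\|$ denotes the norm of the row operator from $\mathcal{H}^{(n)}$ (direct sum of $n$ copies of $\mathcal{H}$) to $\mathcal{H}$, i.e. $\|X_1X_1^*+\cdots+X_nX_n^*\|^{1/2}$. $B(\mathcal{K})$ is the algebra of bounded linear operators on $\mathcal{K}$, and $\mathcal{K}\otimes\mathcal{H}$ is the Hilbert space tensor product. The conventions $1/0=\infty$, $1/\infty=0$ are used.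
   Formalization: Uniqueness of R is claimed only for infinite-dimensional H; for finite-dimensional H property (ii) is vacuous and uniqueness fails (e.g. H = ℂ, n = 1, all A_(α) = 0: then R = ∞, but 1 also satisfies (i) and (ii)). *)

theory Defs
  imports "HOL-Analysis.Analysis"
begin

section \<open>Complex Hilbert spaces\<close>

class scaleC =
  fixes scaleC :: "complex \<Rightarrow> 'a \<Rightarrow> 'a" (infixr "*\<^sub>C" 75)

class complex_vector = real_vector + scaleC +
  assumes scaleC_add_right: "a *\<^sub>C (x + y) = a *\<^sub>C x + a *\<^sub>C y"
    and scaleC_add_left: "(a + b) *\<^sub>C x = a *\<^sub>C x + b *\<^sub>C x"
    and scaleC_scaleC: "a *\<^sub>C (b *\<^sub>C x) = (a * b) *\<^sub>C x"
    and scaleC_one: "1 *\<^sub>C x = x"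
    and scaleR_scaleC: "r *\<^sub>R x = complex_of_real r *\<^sub>C x"

global_interpretation complex_vector: vector_space "scaleC :: complex \<Rightarrow> 'a \<Rightarrow> 'a::complex_vector"
  defines cspan = complex_vector.span
  by unfold_locales (simp_all add: scaleC_add_right scaleC_add_left scaleC_scaleC scaleC_one)

text \<open>The inner product is linear in the first and antilinear in the second argument.\<close>

class cinner_space = complex_vector +
  fixes cinner :: "'a \<Rightarrow> 'a \<Rightarrow> complex"
  assumes cinner_commute: "cinner x y = cnj (cinner y x)"
    and cinner_add_left: "cinner (x + y) z = cinner x z + cinner y z"
    and cinner_scaleC_left: "cinner (c *\<^sub>C x) y = c * cinner x y"
    and cinner_ge_zero: "0 \<le> Re (cinner x x)"
    and cinner_eq_zero: "cinner x x = 0 \<Longrightarrow> x = 0"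
begin

lemma cinner_add_right: "cinner x (y + z) = cinner x y + cinner x z"
  using cinner_add_left[of y z x] by (metis cinner_commute complex_cnj_add)

lemma cinner_scaleC_right: "cinner x (c *\<^sub>C y) = cnj c * cinner x y"
  using cinner_scaleC_left[of c y x] by (metis cinner_commute complex_cnj_mult)

lemma cinner_zero_left: "cinner 0 x = 0"
  using cinner_add_left[of 0 0 x] by simp

lemma cinner_zero_right: "cinner x 0 = 0"
  using cinner_add_right[of x 0 0] by simp

lemma cinner_minus_left: "cinner (- x) y = - cinner x y"
  using group_add_class.minus_unique[of "cinner x y" "cinner (- x) y"] cinner_add_left[of x "- x" y]
  by (simp add: cinner_zero_left)

lemma cinner_minus_right: "cinner x (- y) = - cinner x y"
  using group_add_class.minus_unique[of "cinner x y" "cinner x (- y)"] cinner_add_right[of x y "- y"]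
  by (simp add: cinner_zero_right)

lemma cinner_diff_left: "cinner (x - y) z = cinner x z - cinner y z"
  using cinner_add_left[of x "- y" z] by (simp add: cinner_minus_left)

lemma cinner_diff_right: "cinner x (y - z) = cinner x y - cinner x z"
  using cinner_add_right[of x y "- z"] by (simp add: cinner_minus_right)

lemma Im_cinner_self: "Im (cinner x x) = 0"
  using cinner_commute[of x x] by (metis Reals_cnj_iff complex_is_Real_iff)

lemma cinner_self_of_real: "cinner x x = complex_of_real (Re (cinner x x))"
  by (simp add: complex_eq_iff Im_cinner_self)

lemma cinner_Cauchy_Schwarz:
  "cmod (cinner x y) \<le> sqrt (Re (cinner x x)) * sqrt (Re (cinner y y))"
proof (cases "y = 0")
  case True
  then show ?thesis by (simp add: cinner_zero_right)
next
  case False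
  define q where "q = Re (cinner y y)"
  define z where "z = cinner x y"
  have yy: "cinner y y = complex_of_real q"
    unfolding q_def by (rule cinner_self_of_real)
  have q: "q > 0"
    using cinner_ge_zero[of y] cinner_eq_zero[of y] False yy unfolding q_def
    by (metis of_real_0 order_le_less)
  have yx: "cinner y x = cnj z"
    unfolding z_def by (rule cinner_commute)
  have "0 \<le> Re (cinner (x - (z / q) *\<^sub>C y) (x - (z / q) *\<^sub>C y))"
    by (rule cinner_ge_zero)
  also have "cinner (x - (z / q) *\<^sub>C y) (x - (z / q) *\<^sub>C y) = cinner x x - z * cnj z / q"
    using q by (simp add: cinner_diff_left cinner_diff_right cinner_scaleC_left
        cinner_scaleC_right yy yx z_def[symmetric] field_simps)
  also have "\<dots> = cinner x x - complex_of_real ((cmod z)\<^sup>2 / q)"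
    by (simp only: of_real_divide complex_norm_square)
  finally have "(cmod z)\<^sup>2 / q \<le> Re (cinner x x)" by simp
  then have "(cmod z)\<^sup>2 \<le> Re (cinner x x) * q"
    using q by (simp add: pos_divide_le_eq)
  then have "cmod z \<le> sqrt (Re (cinner x x) * q)"
    by (rule real_le_rsqrt)
  then show ?thesis unfolding z_def q_def by (simp add: real_sqrt_mult)
qed

lemma cinner_triangle:
  "sqrt (Re (cinner (x + y) (x + y))) \<le> sqrt (Re (cinner x x)) + sqrt (Re (cinner y y))"
proof (rule real_le_lsqrt)
  have "Re (cinner y x) = Re (cinner x y)"
    by (metis cinner_commute cnj.simps(1))
  then have "Re (cinner (x + y) (x + y)) = Re (cinner x x) + 2 * Re (cinner x y) + Re (cinner y y)"
    by (simp add: cinner_add_left cinner_add_right)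
  moreover have "Re (cinner x y) \<le> sqrt (Re (cinner x x)) * sqrt (Re (cinner y y))"
    using cinner_Cauchy_Schwarz[of x y] complex_Re_le_cmod[of "cinner x y"] by linarith
  ultimately show "Re (cinner (x + y) (x + y)) \<le> (sqrt (Re (cinner x x)) + sqrt (Re (cinner y y)))\<^sup>2"
    by (simp add: power2_sum cinner_ge_zero)
qed (simp add: cinner_ge_zero)

end

class complex_inner = cinner_space + real_normed_vector +
  assumes norm_eq_sqrt_cinner: "norm x = sqrt (Re (cinner x x))"

class chilbert_space = complex_inner + complete_space

lemma cinner_self: "cinner x x = complex_of_real ((norm x)\<^sup>2)" for x :: "'a::complex_inner"
proof -
  have "(norm x)\<^sup>2 = Re (cinner x x)" by (simp add: norm_eq_sqrt_cinner cinner_ge_zero)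
  then show ?thesis by (metis cinner_self_of_real)
qed

lemma cmod_cinner_le: "cmod (cinner x y) \<le> norm x * norm y" for x y :: "'a::complex_inner"
  by (simp add: norm_eq_sqrt_cinner cinner_Cauchy_Schwarz)

definition infinite_dimensional :: "'a::complex_vector itself \<Rightarrow> bool" where
  "infinite_dimensional _ \<longleftrightarrow> \<not> (\<exists>B :: 'a set. finite B \<and> cspan B = UNIV)"


section \<open>The algebra of bounded operators\<close>

typedef (overloaded) 'a bop =
  "{f :: 'a::complex_inner \<Rightarrow> 'a. bounded_linear f \<and> (\<forall>c x. f (c *\<^sub>C x) = c *\<^sub>C f x)}"
  morphisms bop_apply Bop
  by (rule exI[of _ "\<lambda>x. x"]) (simp add: bounded_linear_ident)

setup_lifting type_definition_bop

lemma bounded_linear_bop_apply: "bounded_linear (bop_apply A)"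
  using bop_apply by blast

instantiation bop :: (complex_inner) real_normed_vector
begin

lift_definition zero_bop :: "'a bop" is "\<lambda>x. 0" by (simp add: bounded_linear_zero)

lift_definition plus_bop :: "'a bop \<Rightarrow> 'a bop \<Rightarrow> 'a bop" is "\<lambda>f g x. f x + g x"
  by (simp add: bounded_linear_add scaleC_add_right)

lift_definition uminus_bop :: "'a bop \<Rightarrow> 'a bop" is "\<lambda>f x. - f x"
  by (simp add: bounded_linear_minus)

lift_definition minus_bop :: "'a bop \<Rightarrow> 'a bop \<Rightarrow> 'a bop" is "\<lambda>f g x. f x - g x"
  by (simp add: bounded_linear_sub complex_vector.scale_right_diff_distrib)

lift_definition scaleR_bop :: "real \<Rightarrow> 'a bop \<Rightarrow> 'a bop" is "\<lambda>r f x. r *\<^sub>R f x"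
  by (auto intro!: bounded_linear_const_scaleR)
    (simp add: scaleR_scaleC scaleC_scaleC mult.commute)

lift_definition norm_bop :: "'a bop \<Rightarrow> real" is onorm .

definition dist_bop :: "'a bop \<Rightarrow> 'a bop \<Rightarrow> real" where "dist_bop A B = norm (A - B)"
definition sgn_bop :: "'a bop \<Rightarrow> 'a bop" where "sgn_bop A = inverse (norm A) *\<^sub>R A"
definition uniformity_bop :: "('a bop \<times> 'a bop) filter" where
  "uniformity_bop = (INF e\<in>{0<..}. principal {(x, y). dist x y < e})"
definition open_bop :: "'a bop set \<Rightarrow> bool" where
  "open_bop U \<longleftrightarrow> (\<forall>x\<in>U. \<forall>\<^sub>F (x', y) in uniformity. x' = x \<longrightarrow> y \<in> U)"

instance
proof
  fix A B C :: "'a bop" and r s :: real and U :: "'a bop set"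
  show "A + B + C = A + (B + C)" by transfer (simp add: add.assoc)
  show "A + B = B + A" by transfer (simp add: add.commute)
  show "0 + A = A" by transfer simp
  show "- A + A = 0" by transfer simp
  show "A - B = A + - B" by transfer simp
  show "r *\<^sub>R (A + B) = r *\<^sub>R A + r *\<^sub>R B" by transfer (simp add: scaleR_add_right)
  show "(r + s) *\<^sub>R A = r *\<^sub>R A + s *\<^sub>R A" by transfer (simp add: scaleR_add_left)
  show "r *\<^sub>R s *\<^sub>R A = (r * s) *\<^sub>R A" by transfer simp
  show "1 *\<^sub>R A = A" by transfer simp
  show "dist A B = norm (A - B)" by (rule dist_bop_def)
  show "sgn A = inverse (norm A) *\<^sub>R A" by (rule sgn_bop_def)
  show "uniformity = (INF e\<in>{0<..}. principal {(x :: 'a bop, y). dist x y < e})"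
    by (rule uniformity_bop_def)
  show "open U \<longleftrightarrow> (\<forall>x\<in>U. \<forall>\<^sub>F (x', y) in uniformity. x' = x \<longrightarrow> y \<in> U)"
    by (rule open_bop_def)
  show "norm A = 0 \<longleftrightarrow> A = 0" by transfer (auto simp: onorm_eq_0 fun_eq_iff)
  show "norm (A + B) \<le> norm A + norm B" by transfer (simp add: onorm_triangle)
  show "norm (r *\<^sub>R A) = \<bar>r\<bar> * norm A" by transfer (simp add: onorm_scaleR)
qed

end

text \<open>Multiplication is composition of operators.\<close>

instantiation bop :: (complex_inner) "{real_normed_algebra, monoid_mult}"
begin

lift_definition one_bop :: "'a bop" is "\<lambda>x. x" by (simp add: bounded_linear_ident)

lift_definition times_bop :: "'a bop \<Rightarrow> 'a bop \<Rightarrow> 'a bop" is "\<lambda>f g x. f (g x)"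
  by (simp add: bounded_linear_compose)

instance
proof
  fix A B C :: "'a bop" and r :: real
  show "A * B * C = A * (B * C)" by transfer simp
  show "(A + B) * C = A * C + B * C" by transfer simp
  show "A * (B + C) = A * B + A * C" by transfer (simp add: linear_simps)
  show "r *\<^sub>R A * B = r *\<^sub>R (A * B)" by transfer simp
  show "A * r *\<^sub>R B = r *\<^sub>R (A * B)" by transfer (simp add: linear_simps)
  show "norm (A * B) \<le> norm A * norm B" by transfer (simp add: onorm_compose[unfolded o_def])
  show "1 * A = A" by transfer simp
  show "A * 1 = A" by transfer simp
qed

end

definition adj :: "'a::chilbert_space bop \<Rightarrow> 'a bop" where
  "adj A = (THE B. \<forall>x y. cinner (bop_apply A x) y = cinner x (bop_apply B y))"


section \<open>The algebraic tensor product\<close>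

text \<open>
  The simple tensor of \<open>a\<close> and \<open>b\<close> is represented by the form
  \<open>(c, d) \<mapsto> \<langle>a, c\<rangle> \<langle>b, d\<rangle>\<close>, i.e. by its inner products with all simple tensors;
  the algebraic tensor product is the set of finite sums of these.
\<close>

definition tensor_form ::
    "('a::complex_inner \<times> 'b::complex_inner) list \<Rightarrow> 'a \<Rightarrow> 'b \<Rightarrow> complex" where
  "tensor_form w = (\<lambda>c d. \<Sum>(a, b)\<leftarrow>w. cinner a c * cinner b d)"

lemma tensor_form_Nil: "tensor_form [] = (\<lambda>c d. 0)"
  and tensor_form_Cons: "tensor_form ((a, b) # w) = (\<lambda>c d. cinner a c * cinner b d + tensor_form w c d)"
  and tensor_form_append: "tensor_form (v @ w) = (\<lambda>c d. tensor_form v c d + tensor_form w c d)"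
  by (simp_all add: tensor_form_def)

lemma tensor_form_scaleC:
  "tensor_form (map (\<lambda>(a, b). (z *\<^sub>C a, b)) w) = (\<lambda>c d. z * tensor_form w c d)"
  by (induction w)
    (auto simp: tensor_form_Nil tensor_form_Cons cinner_scaleC_left fun_eq_iff algebra_simps)

typedef (overloaded) ('a, 'b) atensor =
  "range (tensor_form :: ('a::complex_inner \<times> 'b::complex_inner) list \<Rightarrow> _)"
  morphisms atensor_form Abs_atensor
  by blast

setup_lifting type_definition_atensor

lift_definition atensor_of :: "('a::complex_inner \<times> 'b::complex_inner) list \<Rightarrow> ('a, 'b) atensor"
  is tensor_form by simp

lemma ex_atensor_of: "\<exists>w. t = atensor_of w"
  by transfer auto

instantiation atensor :: (complex_inner, complex_inner) complex_vector
begin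

lift_definition zero_atensor :: "('a, 'b) atensor" is "\<lambda>c d. 0"
  by (rule range_eqI[of _ _ "[]"]) (simp add: tensor_form_Nil)

lift_definition plus_atensor :: "('a, 'b) atensor \<Rightarrow> ('a, 'b) atensor \<Rightarrow> ('a, 'b) atensor"
  is "\<lambda>f g c d. f c d + g c d"
  by (auto simp flip: tensor_form_append)

lift_definition scaleC_atensor :: "complex \<Rightarrow> ('a, 'b) atensor \<Rightarrow> ('a, 'b) atensor"
  is "\<lambda>z f c d. z * f c d"
  by (auto simp flip: tensor_form_scaleC)

definition scaleR_atensor :: "real \<Rightarrow> ('a, 'b) atensor \<Rightarrow> ('a, 'b) atensor" where
  "scaleR_atensor r t = complex_of_real r *\<^sub>C t"
definition uminus_atensor :: "('a, 'b) atensor \<Rightarrow> ('a, 'b) atensor" where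
  "uminus_atensor t = (-1) *\<^sub>C t"
definition minus_atensor :: "('a, 'b) atensor \<Rightarrow> ('a, 'b) atensor \<Rightarrow> ('a, 'b) atensor" where
  "minus_atensor s t = s + (- t)"

instance
proof
  fix s t u :: "('a, 'b) atensor" and z w :: complex and r q :: real
  show "s + t + u = s + (t + u)" by transfer (simp add: add.assoc)
  show "s + t = t + s" by transfer (simp add: add.commute)
  show "0 + t = t" by transfer simp
  show "- t + t = 0" unfolding uminus_atensor_def by transfer simp
  show "s - t = s + - t" by (rule minus_atensor_def)
  show sC1: "z *\<^sub>C (s + t) = z *\<^sub>C s + z *\<^sub>C t" for z and s t :: "('a, 'b) atensor"
    by transfer (simp add: algebra_simps)
  show sC2: "(z + w) *\<^sub>C t = z *\<^sub>C t + w *\<^sub>C t" for z w and t :: "('a, 'b) atensor"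
    by transfer (simp add: algebra_simps)
  show sC3: "z *\<^sub>C w *\<^sub>C t = (z * w) *\<^sub>C t" for z w and t :: "('a, 'b) atensor"
    by transfer (simp add: algebra_simps)
  show sC4: "1 *\<^sub>C t = t" for t :: "('a, 'b) atensor"
    by transfer simp
  show "r *\<^sub>R t = complex_of_real r *\<^sub>C t" by (rule scaleR_atensor_def)
  show "r *\<^sub>R (s + t) = r *\<^sub>R s + r *\<^sub>R t" by (simp add: scaleR_atensor_def sC1)
  show "(r + q) *\<^sub>R t = r *\<^sub>R t + q *\<^sub>R t" by (simp add: scaleR_atensor_def sC2)
  show "r *\<^sub>R q *\<^sub>R t = (r * q) *\<^sub>R t" by (simp add: scaleR_atensor_def sC3)
  show "1 *\<^sub>R t = t" by (simp add: scaleR_atensor_def sC4)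
qed

end

text \<open>
  On finite sums, \<open>\<langle>s, \<Sum>\<^sub>j c\<^sub>j \<otimes> d\<^sub>j\<rangle> = \<Sum>\<^sub>j s(c\<^sub>j, d\<^sub>j)\<close>. This does not depend on the
  chosen representation, see the first lemma below.
\<close>

definition atensor_cinner :: "('a::complex_inner, 'b::complex_inner) atensor \<Rightarrow> ('a, 'b) atensor \<Rightarrow> complex"
  where "atensor_cinner s t = (\<Sum>(c, d)\<leftarrow>(SOME w. t = atensor_of w). atensor_form s c d)"

lemma sum_tensor_form_swap:
  "(\<Sum>(c, d)\<leftarrow>w. tensor_form v c d) = cnj (\<Sum>(a, b)\<leftarrow>v. tensor_form w a b)"
proof (induction w)
  case Nil
  show ?case by (induction v) (auto simp: tensor_form_Nil)
next
  case (Cons p w)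
  obtain c d where p: "p = (c, d)" by force
  have "cnj (\<Sum>(a, b)\<leftarrow>v. tensor_form (p # w) a b)
      = cnj (\<Sum>(a, b)\<leftarrow>v. cinner c a * cinner d b) + cnj (\<Sum>(a, b)\<leftarrow>v. tensor_form w a b)"
    unfolding p tensor_form_Cons by (induction v) auto
  also have "cnj (\<Sum>(a, b)\<leftarrow>v. cinner c a * cinner d b) = tensor_form v c d"
    by (induction v)
      (auto simp: tensor_form_Nil tensor_form_Cons cinner_commute[of c] cinner_commute[of d])
  finally show ?case using Cons.IH p by simp
qed

lemma atensor_cinner_atensor_of:
  "atensor_cinner s (atensor_of w) = (\<Sum>(c, d)\<leftarrow>w. atensor_form s c d)"
proof -
  obtain v where s: "s = atensor_of v" using ex_atensor_of by blast
  have sv: "atensor_form s = tensor_form v" by (simp add: s atensor_of.rep_eq)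
  define w' where "w' = (SOME w'. atensor_of w = (atensor_of w' :: ('a, 'b) atensor))"
  have "atensor_of w = (atensor_of w' :: ('a, 'b) atensor)"
    unfolding w'_def by (rule someI) (rule refl)
  then have "tensor_form w' = tensor_form w" by (metis atensor_of.rep_eq)
  then show ?thesis
    unfolding atensor_cinner_def w'_def[symmetric] sv
    by (simp only: sum_tensor_form_swap[of v w'] sum_tensor_form_swap[of v w])
qed

lemma atensor_orthonormal_representation:
  fixes w :: "('a::complex_inner \<times> 'b::complex_inner) list"
  shows "\<exists>(n::nat) a e. tensor_form w = (\<lambda>c d. \<Sum>k<n. cinner (a k) c * cinner (e k) d) \<and>
    (\<forall>j<n. \<forall>k<n. cinner (e j) (e k) = (if j = k then 1 else 0))"
proof (induction w)
  case Nil
  show ?case by (rule exI[of _ 0]) (simp add: tensor_form_Nil)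
next
  case (Cons p w)
  obtain a0 b0 where p: "p = (a0, b0)" by force
  from Cons obtain n :: nat and a :: "nat \<Rightarrow> 'a" and e :: "nat \<Rightarrow> 'b" where
    w: "tensor_form w = (\<lambda>c d. \<Sum>k<n. cinner (a k) c * cinner (e k) d)" and
    on: "\<And>j k. j < n \<Longrightarrow> k < n \<Longrightarrow> cinner (e j) (e k) = (if j = k then 1 else 0)" by auto
  have cinner_sum_left: "cinner (\<Sum>k\<in>K. f k) y = (\<Sum>k\<in>K. cinner (f k) y)"
    for f :: "nat \<Rightarrow> 'b" and K y
    by (induction K rule: infinite_finite_induct) (auto simp: cinner_zero_left cinner_add_left)
  define g where "g k = cinner b0 (e k)" for k
  define b' where "b' = b0 - (\<Sum>k<n. g k *\<^sub>C e k)"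
  have b0: "b0 = b' + (\<Sum>k<n. g k *\<^sub>C e k)" by (simp add: b'_def)
  have orth: "cinner b' (e j) = 0" if "j < n" for j
  proof -
    have "(\<Sum>k<n. g k * cinner (e k) (e j)) = (\<Sum>k<n. if k = j then g k else 0)"
      using that by (intro sum.cong) (auto simp: on)
    also have "\<dots> = g j" using that by simp
    finally show ?thesis
      by (simp add: b'_def cinner_diff_left cinner_sum_left cinner_scaleC_left g_def)
  qed
  define h where "h = 1 / complex_of_real (norm b')"
  define a' where "a' k = (if k < n then a k + g k *\<^sub>C a0 else complex_of_real (norm b') *\<^sub>C a0)" for k
  define e' where "e' k = (if k < n then e k else h *\<^sub>C b')" for k
  define m where "m = (if b' = 0 then n else Suc n)"
  have form: "tensor_form (p # w) c d = (\<Sum>k<m. cinner (a' k) c * cinner (e' k) d)" for c d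
  proof -
    have "(\<Sum>k<n. cinner (a' k) c * cinner (e' k) d)
        = tensor_form w c d + (\<Sum>k<n. cinner (g k *\<^sub>C a0) c * cinner (e k) d)"
      by (simp add: w a'_def e'_def cinner_add_left ring_distribs sum.distrib)
    also have "(\<Sum>k<n. cinner (g k *\<^sub>C a0) c * cinner (e k) d)
        = cinner a0 c * cinner (\<Sum>k<n. g k *\<^sub>C e k) d"
      by (simp add: cinner_scaleC_left cinner_sum_left sum_distrib_left mult_ac)
    finally have 1: "(\<Sum>k<n. cinner (a' k) c * cinner (e' k) d)
        = tensor_form w c d + cinner a0 c * cinner (\<Sum>k<n. g k *\<^sub>C e k) d" .
    have "(\<Sum>k<m. cinner (a' k) c * cinner (e' k) d)
        = (\<Sum>k<n. cinner (a' k) c * cinner (e' k) d) + cinner a0 c * cinner b' d"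
      by (cases "b' = 0")
        (auto simp: m_def a'_def e'_def h_def cinner_zero_left cinner_scaleC_left)
    then show ?thesis
      unfolding 1 by (simp add: p tensor_form_Cons b0[THEN arg_cong[where f = "\<lambda>x. cinner x d"]]
          cinner_add_left ring_distribs)
  qed
  have "tensor_form (p # w) = (\<lambda>c d. \<Sum>k<m. cinner (a' k) c * cinner (e' k) d)"
    by (intro ext form)
  moreover have "cinner (e' j) (e' k) = (if j = k then 1 else 0)" if "j < m" "k < m" for j k
  proof -
    have orth': "cinner (e j) b' = 0" if "j < n" for j
      using orth[OF that] cinner_commute[of "e j" b'] by simp
    have "cinner b' b' = complex_of_real (norm b') * complex_of_real (norm b')"
      by (simp add: cinner_self power2_eq_square)
    then have "cinner (h *\<^sub>C b') (h *\<^sub>C b') = 1" if "b' \<noteq> 0"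
      using that by (simp add: cinner_scaleC_left cinner_scaleC_right h_def)
    then show ?thesis
      using that on[of j k] orth orth'
      by (cases "b' = 0") (auto simp: m_def e'_def cinner_scaleC_left cinner_scaleC_right)
  qed
  ultimately show ?case
    by (intro exI[of _ m] exI[of _ a'] exI[of _ e'] conjI allI impI)
qed

instantiation atensor :: (complex_inner, complex_inner) cinner_space
begin

definition cinner_atensor :: "('a, 'b) atensor \<Rightarrow> ('a, 'b) atensor \<Rightarrow> complex" where
  "cinner_atensor = atensor_cinner"

instance
proof
  fix s t u :: "('a, 'b) atensor" and z :: complex
  show "cinner s t = cnj (cinner t s)"
  proof -
    obtain v w where "s = atensor_of v" "t = atensor_of w" using ex_atensor_of by blast
    then show ?thesis
      using sum_tensor_form_swap[of v w]
      by (simp add: cinner_atensor_def atensor_cinner_atensor_of atensor_of.rep_eq)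
  qed
  show "cinner (s + t) u = cinner s u + cinner t u"
    by (simp add: cinner_atensor_def atensor_cinner_def plus_atensor.rep_eq sum_list_addf
        split_def)
  show "cinner (z *\<^sub>C s) t = z * cinner s t"
    by (simp add: cinner_atensor_def atensor_cinner_def scaleC_atensor.rep_eq sum_list_const_mult
        split_def)
  obtain w where w: "t = atensor_of w" using ex_atensor_of by blast
  obtain n :: nat and a :: "nat \<Rightarrow> 'a" and e :: "nat \<Rightarrow> 'b" where
    f: "tensor_form w = (\<lambda>c d. \<Sum>k<n. cinner (a k) c * cinner (e k) d)" and
    on: "\<And>j k. j < n \<Longrightarrow> k < n \<Longrightarrow> cinner (e j) (e k) = (if j = k then 1 else 0)"
    using atensor_orthonormal_representation[of w] by auto
  have "tensor_form (map (\<lambda>k. (a k, e k)) [0..<n]) = tensor_form w"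
    unfolding f
    by (simp add: tensor_form_def comp_def interv_sum_list_conv_sum_set_nat atLeast0LessThan)
  then have t: "t = atensor_of (map (\<lambda>k. (a k, e k)) [0..<n])"
    unfolding w by (simp add: atensor_form_inject[symmetric] atensor_of.rep_eq)
  have "cinner t t = (\<Sum>k<n. \<Sum>j<n. cinner (a j) (a k) * cinner (e j) (e k))"
    unfolding cinner_atensor_def
    apply (subst (2) t)
    unfolding atensor_cinner_atensor_of
    by (simp add: w atensor_of.rep_eq f comp_def interv_sum_list_conv_sum_set_nat atLeast0LessThan)
  also have "\<dots> = (\<Sum>k<n. \<Sum>j<n. if j = k then cinner (a j) (a k) else 0)"
    by (intro sum.cong) (auto simp: on)
  also have "\<dots> = (\<Sum>k<n. complex_of_real ((norm (a k))\<^sup>2))"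
    by (intro sum.cong) (auto simp: cinner_self)
  finally have tt: "cinner t t = complex_of_real (\<Sum>k<n. (norm (a k))\<^sup>2)" by simp
  show "0 \<le> Re (cinner t t)" unfolding tt by (simp add: sum_nonneg)
  show "t = 0" if "cinner t t = 0"
  proof -
    have "(\<Sum>k<n. (norm (a k))\<^sup>2) = 0" using that unfolding tt of_real_eq_0_iff .
    then have "\<forall>k<n. a k = 0" by (simp add: sum_nonneg_eq_0_iff)
    then have "tensor_form w = (\<lambda>c d. 0)" by (simp add: f cinner_zero_left)
    then show ?thesis 
      unfolding w by (simp add: atensor_form_inject[symmetric] atensor_of.rep_eq zero_atensor.rep_eq)
  qed
qed

end

instantiation atensor :: (complex_inner, complex_inner) complex_inner
begin

definition norm_atensor :: "('a, 'b) atensor \<Rightarrow> real" where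
  "norm_atensor t = sqrt (Re (cinner t t))"
definition dist_atensor :: "('a, 'b) atensor \<Rightarrow> ('a, 'b) atensor \<Rightarrow> real" where
  "dist_atensor s t = norm (s - t)"
definition sgn_atensor :: "('a, 'b) atensor \<Rightarrow> ('a, 'b) atensor" where
  "sgn_atensor t = inverse (norm t) *\<^sub>R t"
definition uniformity_atensor :: "(('a, 'b) atensor \<times> ('a, 'b) atensor) filter" where
  "uniformity_atensor = (INF e\<in>{0<..}. principal {(x, y). dist x y < e})"
definition open_atensor :: "('a, 'b) atensor set \<Rightarrow> bool" where
  "open_atensor U \<longleftrightarrow> (\<forall>x\<in>U. \<forall>\<^sub>F (x', y) in uniformity. x' = x \<longrightarrow> y \<in> U)"

instance
proof
  fix s t :: "('a, 'b) atensor" and r :: real and U :: "('a, 'b) atensor set"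
  show "dist s t = norm (s - t)" by (rule dist_atensor_def)
  show "sgn t = inverse (norm t) *\<^sub>R t" by (rule sgn_atensor_def)
  show "uniformity = (INF e\<in>{0<..}. principal {(x :: ('a, 'b) atensor, y). dist x y < e})"
    by (rule uniformity_atensor_def)
  show "open U \<longleftrightarrow> (\<forall>x\<in>U. \<forall>\<^sub>F (x', y) in uniformity. x' = x \<longrightarrow> y \<in> U)"
    by (rule open_atensor_def)
  show "norm t = 0 \<longleftrightarrow> t = 0"
    by (metis cinner_eq_zero cinner_self_of_real cinner_zero_left norm_atensor_def of_real_0
        real_sqrt_eq_zero_cancel_iff zero_complex.simps(1))
  show "norm (s + t) \<le> norm s + norm t"
    unfolding norm_atensor_def by (rule cinner_triangle)
  have "cinner (r *\<^sub>R t) (r *\<^sub>R t) = complex_of_real (r\<^sup>2) * cinner t t"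
    by (simp add: scaleR_scaleC cinner_scaleC_left cinner_scaleC_right power2_eq_square)
  then show "norm (r *\<^sub>R t) = \<bar>r\<bar> * norm t"
    by (simp add: norm_atensor_def real_sqrt_mult del: of_real_power)
  show "norm t = sqrt (Re (cinner t t))" by (rule norm_atensor_def)
qed

end


section \<open>Completion of an inner product space\<close>

text \<open>
  The space is embedded isometrically by \<open>x \<mapsto> \<langle>x, -\<rangle>\<close> in the Banach space of bounded
  (real-linear) functionals, and the completion is the closure of its image there.
\<close>

lemma bounded_linear_cinner_right: "bounded_linear (cinner x)" for x :: "'a::complex_inner"
proof (rule bounded_linear_intro)
  show "cinner x (y + z) = cinner x y + cinner x z" for y z by (rule cinner_add_right)
  show "cinner x (r *\<^sub>R y) = r *\<^sub>R cinner x y" for r y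
    by (simp add: scaleR_scaleC[of r y] cinner_scaleC_right scaleR_conv_of_real)
  show "norm (cinner x y) \<le> norm y * norm x" for y
    using cmod_cinner_le[of x y] by (simp add: mult.commute)
qed

lift_definition functional_of :: "'a::complex_inner \<Rightarrow> 'a \<Rightarrow>\<^sub>L complex" is cinner
  by (rule bounded_linear_cinner_right)

definition functional_scaleC :: "complex \<Rightarrow> ('a::complex_inner \<Rightarrow>\<^sub>L complex) \<Rightarrow> 'a \<Rightarrow>\<^sub>L complex" where
  "functional_scaleC c F = blinfun_mult_right c o\<^sub>L F"

lemma functional_scaleC_apply: "blinfun_apply (functional_scaleC c F) x = c * blinfun_apply F x"
  by (simp add: functional_scaleC_def)

lemma functional_of_add: "functional_of (x + y) = functional_of x + functional_of y"
  by (rule blinfun_eqI) (simp add: functional_of.rep_eq cinner_add_left blinfun.add_left)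

lemma functional_of_scaleC: "functional_of (c *\<^sub>C x) = functional_scaleC c (functional_of x)"
  by (rule blinfun_eqI) (simp add: functional_of.rep_eq cinner_scaleC_left functional_scaleC_apply)

lemma functional_of_scaleR: "functional_of (r *\<^sub>R x) = r *\<^sub>R functional_of x"
  by (rule blinfun_eqI)
    (simp add: functional_of.rep_eq scaleR_scaleC cinner_scaleC_left blinfun.scaleR_left
      scaleR_conv_of_real)

lemma norm_functional_of: "norm (functional_of x) = norm x"
proof (rule antisym)
  show "norm (functional_of x) \<le> norm x"
    by (rule norm_blinfun_bound) (simp_all add: functional_of.rep_eq cmod_cinner_le)
  show "norm x \<le> norm (functional_of x)"
  proof (cases "x = 0")
    case False
    have "norm x * norm x = cmod (functional_of x x)"
      by (simp add: functional_of.rep_eq cinner_self power2_eq_square norm_mult)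
    also have "\<dots> \<le> norm (functional_of x) * norm x" by (rule norm_blinfun)
    finally show ?thesis using False by simp
  qed simp
qed

typedef (overloaded) 'a completion =
  "closure (range (functional_of :: 'a::complex_inner \<Rightarrow> 'a \<Rightarrow>\<^sub>L complex))"
  by (rule exI[of _ "functional_of 0"]) (simp add: closure_subset[THEN subsetD])

setup_lifting type_definition_completion

lemma subspace_closure_functionals:
  "subspace (closure (range (functional_of :: 'a::complex_inner \<Rightarrow> 'a \<Rightarrow>\<^sub>L complex)))"
proof -
  have subspace_closure: "subspace (closure S)" if "subspace S" for S :: "('a \<Rightarrow>\<^sub>L complex) set"
  proof (rule subspaceI)
    show "0 \<in> closure S" using subspace_0[OF that] closure_subset by blast
  next
    fix F G assume "F \<in> closure S" "G \<in> closure S"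
    then obtain f g where "\<And>n. f n \<in> S" "f \<longlonglongrightarrow> F" "\<And>n. g n \<in> S" "g \<longlonglongrightarrow> G"
      unfolding closure_sequential by blast
    then have "\<forall>n. f n + g n \<in> S" "(\<lambda>n. f n + g n) \<longlonglongrightarrow> F + G"
      using subspace_add[OF that] by (auto intro: tendsto_add)
    then show "F + G \<in> closure S"
      unfolding closure_sequential by (intro exI[of _ "\<lambda>n. f n + g n"]) simp
  next
    fix r F assume "F \<in> closure S"
    then obtain f where "\<And>n. f n \<in> S" "f \<longlonglongrightarrow> F"
      unfolding closure_sequential by blast
    then have "\<forall>n. r *\<^sub>R f n \<in> S" "(\<lambda>n. r *\<^sub>R f n) \<longlonglongrightarrow> r *\<^sub>R F"
      using subspace_scale[OF that] by (auto intro: tendsto_scaleR)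
    then show "r *\<^sub>R F \<in> closure S"
      unfolding closure_sequential by (intro exI[of _ "\<lambda>n. r *\<^sub>R f n"]) simp
  qed
  have "linear (functional_of :: 'a \<Rightarrow> 'a \<Rightarrow>\<^sub>L complex)"
    by (rule linearI) (simp_all add: functional_of_add functional_of_scaleR)
  then have "subspace (range (functional_of :: 'a \<Rightarrow> 'a \<Rightarrow>\<^sub>L complex))"
    by (rule linear_subspace_image) simp
  then show ?thesis by (rule subspace_closure)
qed

lemma functional_scaleC_closure:
  assumes "F \<in> closure (range (functional_of :: 'a::complex_inner \<Rightarrow> 'a \<Rightarrow>\<^sub>L complex))"
  shows "functional_scaleC c F \<in> closure (range functional_of)"
proof -
  let ?S = "range (functional_of :: 'a \<Rightarrow> 'a \<Rightarrow>\<^sub>L complex)"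
  have "functional_scaleC c ` closure ?S \<subseteq> closure ?S"
  proof (rule image_closure_subset)
    show "continuous_on (closure ?S) (functional_scaleC c)"
      unfolding functional_scaleC_def by (intro continuous_intros)
    show "functional_scaleC c ` ?S \<subseteq> closure ?S"
      using closure_subset[of ?S] by (auto simp flip: functional_of_scaleC)
  qed simp
  with assms show ?thesis by blast
qed

instantiation completion :: (complex_inner) complex_vector
begin

lift_definition zero_completion :: "'a completion" is 0
  by (rule subspace_0[OF subspace_closure_functionals])
lift_definition plus_completion :: "'a completion \<Rightarrow> 'a completion \<Rightarrow> 'a completion" is "(+)"
  by (rule subspace_add[OF subspace_closure_functionals])
lift_definition uminus_completion :: "'a completion \<Rightarrow> 'a completion" is uminus
  by (rule subspace_neg[OF subspace_closure_functionals])
lift_definition minus_completion :: "'a completion \<Rightarrow> 'a completion \<Rightarrow> 'a completion" is "(-)"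
  by (rule subspace_diff[OF subspace_closure_functionals])
lift_definition scaleR_completion :: "real \<Rightarrow> 'a completion \<Rightarrow> 'a completion" is scaleR
  by (rule subspace_scale[OF subspace_closure_functionals])
lift_definition scaleC_completion :: "complex \<Rightarrow> 'a completion \<Rightarrow> 'a completion"
  is functional_scaleC
  by (rule functional_scaleC_closure)

instance
proof
  fix x y z :: "'a completion" and c d :: complex and r s :: real
  show "x + y + z = x + (y + z)" by transfer (simp add: add.assoc)
  show "x + y = y + x" by transfer (simp add: add.commute)
  show "0 + x = x" by transfer simp
  show "- x + x = 0" by transfer simp
  show "x - y = x + - y" by transfer simp
  show "r *\<^sub>R (x + y) = r *\<^sub>R x + r *\<^sub>R y" by transfer (simp add: scaleR_add_right)
  show "(r + s) *\<^sub>R x = r *\<^sub>R x + s *\<^sub>R x" by transfer (simp add: scaleR_add_left)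
  show "r *\<^sub>R s *\<^sub>R x = (r * s) *\<^sub>R x" by transfer simp
  show "1 *\<^sub>R x = x" by transfer simp
  show "c *\<^sub>C (x + y) = c *\<^sub>C x + c *\<^sub>C y"
    by transfer (rule blinfun_eqI, simp add: functional_scaleC_apply blinfun.add_left algebra_simps)
  show "(c + d) *\<^sub>C x = c *\<^sub>C x + d *\<^sub>C x"
    by transfer (rule blinfun_eqI, simp add: functional_scaleC_apply blinfun.add_left algebra_simps)
  show "c *\<^sub>C d *\<^sub>C x = (c * d) *\<^sub>C x"
    by transfer (rule blinfun_eqI, simp add: functional_scaleC_apply)
  show "1 *\<^sub>C x = x"
    by transfer (rule blinfun_eqI, simp add: functional_scaleC_apply)
  show "r *\<^sub>R x = complex_of_real r *\<^sub>C x"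
    by transfer (rule blinfun_eqI,
        simp add: functional_scaleC_apply blinfun.scaleR_left scaleR_conv_of_real)
qed

end

instantiation completion :: (complex_inner) real_normed_vector
begin

lift_definition norm_completion :: "'a completion \<Rightarrow> real" is norm .
definition dist_completion :: "'a completion \<Rightarrow> 'a completion \<Rightarrow> real" where
  "dist_completion x y = norm (x - y)"
definition sgn_completion :: "'a completion \<Rightarrow> 'a completion" where
  "sgn_completion x = inverse (norm x) *\<^sub>R x"
definition uniformity_completion :: "('a completion \<times> 'a completion) filter" where
  "uniformity_completion = (INF e\<in>{0<..}. principal {(x, y). dist x y < e})"
definition open_completion :: "'a completion set \<Rightarrow> bool" where
  "open_completion U \<longleftrightarrow> (\<forall>x\<in>U. \<forall>\<^sub>F (x', y) in uniformity. x' = x \<longrightarrow> y \<in> U)"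

instance
proof
  fix x y :: "'a completion" and r :: real and U :: "'a completion set"
  show "dist x y = norm (x - y)" by (rule dist_completion_def)
  show "sgn x = inverse (norm x) *\<^sub>R x" by (rule sgn_completion_def)
  show "uniformity = (INF e\<in>{0<..}. principal {(x :: 'a completion, y). dist x y < e})"
    by (rule uniformity_completion_def)
  show "open U \<longleftrightarrow> (\<forall>x\<in>U. \<forall>\<^sub>F (x', y) in uniformity. x' = x \<longrightarrow> y \<in> U)"
    by (rule open_completion_def)
  show "norm x = 0 \<longleftrightarrow> x = 0" by transfer simp
  show "norm (x + y) \<le> norm x + norm y" by transfer (rule norm_triangle_ineq)
  show "norm (r *\<^sub>R x) = \<bar>r\<bar> * norm x" by transfer simp
qed

end

lift_definition to_completion :: "'a::complex_inner \<Rightarrow> 'a completion" is functional_of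
  by (simp add: closure_subset[THEN subsetD])

lemma to_completion_add: "to_completion (x + y) = to_completion x + to_completion y"
  by transfer (rule functional_of_add)

lemma to_completion_scaleC: "to_completion (c *\<^sub>C x) = c *\<^sub>C to_completion x"
  by transfer (rule functional_of_scaleC)

lemma to_completion_diff: "to_completion (x - y) = to_completion x - to_completion y"
  using to_completion_add[of "x - y" y] by simp

lemma norm_to_completion: "norm (to_completion x) = norm x"
  by transfer (rule norm_functional_of)

lemma closure_range_to_completion:
  "closure (range (to_completion :: 'a::complex_inner \<Rightarrow> 'a completion)) = UNIV"
proof -
  have "\<exists>y. dist (to_completion y) x < e" if "e > 0" for x :: "'a completion" and e
    using that unfolding dist_norm by transfer (auto simp: closure_approachable dist_norm)
  then show ?thesis by (auto simp: closure_approachable)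
qed

lemma completion_induct:
  fixes x :: "'a::complex_inner completion"
  assumes "closed {x. P x}" and "\<And>y. P (to_completion y)"
  shows "P x"
proof -
  have "closure (range to_completion) \<subseteq> {x. P x}"
    using assms by (intro closure_minimal) auto
  then show ?thesis by (auto simp: closure_range_to_completion)
qed

lemma norm_scaleC_completion: "norm (c *\<^sub>C x) = cmod c * norm x" for x :: "'a::complex_inner completion"
proof (transfer fixing: c)
  fix F :: "'a \<Rightarrow>\<^sub>L complex"
  have le: "norm (functional_scaleC c F) \<le> cmod c * norm F" for c and F :: "'a \<Rightarrow>\<^sub>L complex"
    by (rule norm_blinfun_bound)
      (simp_all add: functional_scaleC_apply norm_mult mult.assoc mult_left_mono norm_blinfun)
  show "norm (functional_scaleC c F) = cmod c * norm F"
  proof (cases "c = 0")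
    case True
    then show ?thesis using le[of 0 F] by simp
  next
    case False
    have "functional_scaleC (inverse c) (functional_scaleC c F) = F"
      using False by (intro blinfun_eqI) (simp add: functional_scaleC_apply)
    then have "norm F \<le> cmod (inverse c) * norm (functional_scaleC c F)"
      using le[of "inverse c" "functional_scaleC c F"] by simp
    then have "cmod c * norm F \<le> norm (functional_scaleC c F)"
      using False by (simp add: norm_inverse norm_divide field_simps)
    with le[of c F] show ?thesis by simp
  qed
qed

lemma continuous_on_scaleC_completion [continuous_intros]:
  "continuous_on S f \<Longrightarrow> continuous_on S (\<lambda>x. c *\<^sub>C (f x :: 'a::complex_inner completion))"
proof -
  have "bounded_linear (\<lambda>x :: 'a completion. c *\<^sub>C x)"
    by (rule bounded_linear_intro[where K = "cmod c"])
      (simp_all add: scaleC_add_right scaleR_scaleC scaleC_scaleC norm_scaleC_completion mult.commute)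
  then show "continuous_on S f \<Longrightarrow> continuous_on S (\<lambda>x. c *\<^sub>C f x)"
    by (rule bounded_linear.continuous_on)
qed

text \<open>The inner product of the completion is defined from its norm by polarisation.\<close>

instantiation completion :: (complex_inner) chilbert_space
begin

definition cinner_completion :: "'a completion \<Rightarrow> 'a completion \<Rightarrow> complex" where
  "cinner_completion x y =
    (complex_of_real ((norm (x + y))\<^sup>2) - complex_of_real ((norm (x - y))\<^sup>2)
      + \<i> * complex_of_real ((norm (x + \<i> *\<^sub>C y))\<^sup>2)
      - \<i> * complex_of_real ((norm (x - \<i> *\<^sub>C y))\<^sup>2)) / 4"

lemma cinner_to_completion: "cinner (to_completion x) (to_completion y) = cinner x y"
proof -
  have 1: "complex_of_real ((norm z)\<^sup>2) = cinner z z" for z :: 'a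
    by (rule cinner_self[symmetric])
  show ?thesis
    unfolding cinner_completion_def to_completion_scaleC[symmetric] to_completion_add[symmetric]
      to_completion_diff[symmetric] norm_to_completion 1
    by (simp add: cinner_add_left cinner_add_right cinner_diff_left cinner_diff_right
        cinner_scaleC_left cinner_scaleC_right algebra_simps)
qed

lemma continuous_on_cinner_completion [continuous_intros]:
  fixes f g :: "'b::topological_space \<Rightarrow> 'a completion"
  assumes "continuous_on S f" "continuous_on S g"
  shows "continuous_on S (\<lambda>x. cinner (f x) (g x))"
  unfolding cinner_completion_def by (intro continuous_intros assms) simp_all

instance
proof
  fix x y z :: "'a completion" and c :: complex
  show "cinner x y = cnj (cinner y x)"
  proof -
    have "x + \<i> *\<^sub>C y = \<i> *\<^sub>C (y - \<i> *\<^sub>C x)" "x - \<i> *\<^sub>C y = (- \<i>) *\<^sub>C (y + \<i> *\<^sub>C x)"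
      by (simp_all add: scaleC_add_right complex_vector.scale_right_diff_distrib scaleC_scaleC
          scaleC_one complex_vector.scale_minus_left)
    then have "norm (x + \<i> *\<^sub>C y) = norm (y - \<i> *\<^sub>C x)" "norm (x - \<i> *\<^sub>C y) = norm (y + \<i> *\<^sub>C x)"
      by (simp_all add: norm_scaleC_completion)
    then show ?thesis
      by (simp add: cinner_completion_def add.commute[of x y] norm_minus_commute[of x y])
  qed
  show "cinner (x + y) z = cinner x z + cinner y z"
  proof (induction x rule: completion_induct)
    case 1 show ?case by (intro closed_Collect_eq continuous_intros)
  next
    case (2 x)
    show ?case
    proof (induction y rule: completion_induct)
      case 1 show ?case by (intro closed_Collect_eq continuous_intros)
    next
      case (2 y)
      show ?case
      proof (induction z rule: completion_induct)
        case 1 show ?case by (intro closed_Collect_eq continuous_intros)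
      next
        case (2 z)
        show ?case
          by (simp add: to_completion_add[symmetric] cinner_to_completion cinner_add_left)
      qed
    qed
  qed
  show "cinner (c *\<^sub>C x) y = c * cinner x y"
  proof (induction x rule: completion_induct)
    case 1 show ?case by (intro closed_Collect_eq continuous_intros)
  next
    case (2 x)
    show ?case
    proof (induction y rule: completion_induct)
      case 1 show ?case by (intro closed_Collect_eq continuous_intros)
    next
      case (2 y)
      show ?case
        by (simp add: to_completion_scaleC[symmetric] cinner_to_completion cinner_scaleC_left)
    qed
  qed
  have xx: "cinner x x = complex_of_real ((norm x)\<^sup>2)" for x :: "'a completion"
  proof (induction x rule: completion_induct)
    case 1 show ?case by (intro closed_Collect_eq continuous_intros)
  next
    case (2 x)
    show ?case by (simp only: cinner_to_completion norm_to_completion cinner_self)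
  qed
  show "0 \<le> Re (cinner x x)" by (simp add: xx)
  show "cinner x x = 0 \<Longrightarrow> x = 0" by (simp add: xx)
  show "norm x = sqrt (Re (cinner x x))" by (simp add: xx)
  show "convergent X" if "Cauchy X" for X :: "nat \<Rightarrow> 'a completion"
  proof -
    let ?T = "closure (range (functional_of :: 'a \<Rightarrow> 'a \<Rightarrow>\<^sub>L complex))"
    have dist: "dist (Rep_completion x) (Rep_completion y) = dist x y" for x y :: "'a completion"
      by (simp add: dist_norm minus_completion.rep_eq norm_completion.rep_eq)
    have "Cauchy (\<lambda>n. Rep_completion (X n))"
      using that by (simp add: Cauchy_def dist)
    then have "(\<forall>n. Rep_completion (X n) \<in> ?T) \<and> Cauchy (\<lambda>n. Rep_completion (X n))"
      by (intro conjI allI Rep_completion)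
    moreover have "complete ?T" by (simp add: complete_eq_closed)
    ultimately have "\<exists>F\<in>?T. (\<lambda>n. Rep_completion (X n)) \<longlonglongrightarrow> F"
      unfolding complete_def by (elim allE[of _ "\<lambda>n. Rep_completion (X n)"]) simp
    then obtain F where "F \<in> ?T" "(\<lambda>n. Rep_completion (X n)) \<longlonglongrightarrow> F" ..
    then have "(\<lambda>n. Rep_completion (X n)) \<longlonglongrightarrow> Rep_completion (Abs_completion F)"
      by (simp add: Abs_completion_inverse)
    then have "X \<longlonglongrightarrow> Abs_completion F" by (simp add: tendsto_iff dist)
    then show ?thesis by (rule convergentI)
  qed
qed

end


section \<open>The Hilbert space tensor product\<close>

type_synonym ('a, 'b) htensor = "('a, 'b) atensor completion"

definition tensor :: "'a::complex_inner \<Rightarrow> 'b::complex_inner \<Rightarrow> ('a, 'b) htensor" (infixr "\<otimes>" 70) where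
  "a \<otimes> b = to_completion (atensor_of [(a, b)])"

lemma tensor_add_left: "(a + a') \<otimes> b = a \<otimes> b + a' \<otimes> b"
  unfolding tensor_def to_completion_add[symmetric]
  by (rule arg_cong[where f = to_completion], transfer)
    (simp add: tensor_form_def cinner_add_left ring_distribs)

lemma tensor_add_right: "a \<otimes> (b + b') = a \<otimes> b + a \<otimes> b'"
  unfolding tensor_def to_completion_add[symmetric]
  by (rule arg_cong[where f = to_completion], transfer)
    (simp add: tensor_form_def cinner_add_left ring_distribs)

lemma tensor_scaleC_left: "(z *\<^sub>C a) \<otimes> b = z *\<^sub>C (a \<otimes> b)"
  unfolding tensor_def to_completion_scaleC[symmetric]
  by (rule arg_cong[where f = to_completion], transfer)
    (simp add: tensor_form_def cinner_scaleC_left mult_ac)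

lemma tensor_scaleC_right: "a \<otimes> (z *\<^sub>C b) = z *\<^sub>C (a \<otimes> b)"
  unfolding tensor_def to_completion_scaleC[symmetric]
  by (rule arg_cong[where f = to_completion], transfer)
    (simp add: tensor_form_def cinner_scaleC_left mult_ac)

lemma cinner_tensor: "cinner (a \<otimes> b) (c \<otimes> d) = cinner a c * cinner b d"
  unfolding tensor_def cinner_to_completion cinner_atensor_def atensor_cinner_atensor_of
  by (simp add: atensor_of.rep_eq tensor_form_def)

lemma closure_cspan_tensor:
  "closure (cspan {a \<otimes> b |a b. True}) = (UNIV :: ('a::complex_inner, 'b::complex_inner) htensor set)"
proof -
  have "to_completion (atensor_of w) \<in> cspan {a \<otimes> b |a b. True}"
    for w :: "('a \<times> 'b) list"
  proof (induction w)
    case Nil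
    have "atensor_of [] = (0 *\<^sub>C 0 :: ('a, 'b) atensor)" by transfer (simp add: tensor_form_Nil)
    then have "to_completion (atensor_of []) = (0 :: ('a, 'b) htensor)"
      by (metis to_completion_scaleC complex_vector.scale_zero_left)
    then show ?case by (simp add: complex_vector.span_zero)
  next
    case (Cons p w)
    obtain a b where p: "p = (a, b)" by force
    have "atensor_of (p # w) = atensor_of [(a, b)] + (atensor_of w :: ('a, 'b) atensor)"
      unfolding p by transfer (simp add: tensor_form_def)
    then have "to_completion (atensor_of (p # w)) = a \<otimes> b + to_completion (atensor_of w)"
      by (simp add: to_completion_add tensor_def)
    moreover have "a \<otimes> b \<in> cspan {a \<otimes> b |a b. True}"
      by (rule complex_vector.span_base) blast
    ultimately show ?case
      using Cons.IH by (simp add: complex_vector.span_add)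
  qed
  then have "to_completion t \<in> cspan {a \<otimes> b |a b. True}" for t :: "('a, 'b) atensor"
    using ex_atensor_of[of t] by auto
  then have "range to_completion \<subseteq> cspan {a \<otimes> b |(a::'a) (b::'b). True}"
    by blast
  then have "closure (range to_completion) \<subseteq> closure (cspan {a \<otimes> b |(a::'a) (b::'b). True})"
    by (rule closure_mono)
  then show ?thesis unfolding closure_range_to_completion by (rule top.extremum_uniqueI)
qed

text \<open>
  \<open>A \<otimes>\<^sub>o X\<close> is the bounded operator with \<open>(A \<otimes>\<^sub>o X) (a \<otimes> b) = A a \<otimes> X b\<close>;
  it is unique because the simple tensors span a dense subspace.
\<close>

definition tensor_bop ::
    "'a::chilbert_space bop \<Rightarrow> 'b::chilbert_space bop \<Rightarrow> ('a, 'b) htensor bop" (infixr "\<otimes>\<^sub>o" 70) where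
  "A \<otimes>\<^sub>o X = (THE T. \<forall>a b. bop_apply T (a \<otimes> b) = bop_apply A a \<otimes> bop_apply X b)"


section \<open>Free power series\<close>

text \<open>
  The \<open>n\<close> generators are the elements of a finite type \<open>'n\<close>, and the free semigroup with unit is
  \<open>'n list\<close>.
\<close>

definition word_op :: "('n \<Rightarrow> 'h::chilbert_space bop) \<Rightarrow> 'n list \<Rightarrow> 'h bop" where
  "word_op X \<alpha> = prod_list (map X \<alpha>)"

definition row_norm :: "('n::finite \<Rightarrow> 'h::chilbert_space bop) \<Rightarrow> real" where
  "row_norm X = onorm (\<lambda>v :: 'h ^ 'n. \<Sum>i\<in>UNIV. bop_apply (X i) (v $ i))"

definition homogeneous_part ::
    "('n::finite list \<Rightarrow> 'k::chilbert_space bop) \<Rightarrow> ('n \<Rightarrow> 'h::chilbert_space bop) \<Rightarrow> nat \<Rightarrow>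
      ('k, 'h) htensor bop" where
  "homogeneous_part A X k = (\<Sum>\<alpha> | length \<alpha> = k. A \<alpha> \<otimes>\<^sub>o word_op X \<alpha>)"

definition radius_of_convergence :: "('n::finite list \<Rightarrow> 'k::chilbert_space bop) \<Rightarrow> ennreal" where
  "radius_of_convergence A =
    1 / limsup (\<lambda>k. ennreal (norm (\<Sum>\<alpha> | length \<alpha> = k. adj (A \<alpha>) * A \<alpha>) powr (1 / (2 * real k))))"

definition converges_inside ::
    "'h::chilbert_space itself \<Rightarrow> ('n::finite list \<Rightarrow> 'k::chilbert_space bop) \<Rightarrow> ennreal \<Rightarrow> bool" where
  "converges_inside _ A R \<longleftrightarrow>
    (\<forall>X :: 'n \<Rightarrow> 'h bop. ennreal (row_norm X) < R \<longrightarrow>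
      summable (\<lambda>k. norm (homogeneous_part A X k))) \<and>
    (\<forall>\<rho>\<ge>0. ennreal \<rho> < R \<longrightarrow>
      uniformly_convergent_on {X :: 'n \<Rightarrow> 'h bop. row_norm X \<le> \<rho>}
        (\<lambda>N X. \<Sum>k<N. norm (homogeneous_part A X k)))"

definition diverges_outside ::
    "'h::chilbert_space itself \<Rightarrow> ('n::finite list \<Rightarrow> 'k::chilbert_space bop) \<Rightarrow> ennreal \<Rightarrow> bool" where
  "diverges_outside _ A R \<longleftrightarrow>
    (\<forall>R' :: real. R < ennreal R' \<longrightarrow>
      (\<exists>X :: 'n \<Rightarrow> 'h bop. sqrt (norm (\<Sum>i\<in>UNIV. X i * adj (X i))) = R' \<and>
        \<not> summable (homogeneous_part A X)))"

end

theory Submission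
  imports Defs
begin

text \<open>
  Write \<open>a\<^sub>k = \<parallel>\<Sum>\<^bsub>|\<alpha>|=k\<^esub> A\<^sub>\<alpha>\<^sup>* A\<^sub>\<alpha>\<parallel>\<close>, so that \<open>\<surd>a\<^sub>k\<close> is the norm of the column \<open>(A\<^sub>\<alpha>)\<^bsub>|\<alpha>|=k\<^esub>\<close>.
  The operator \<open>\<Sum>\<^bsub>|\<alpha>|=k\<^esub> A\<^sub>\<alpha> \<otimes> X\<^sub>\<alpha>\<close> is the product of the row \<open>(I \<otimes> X\<^sub>\<alpha>)\<close> and the column
  \<open>(A\<^sub>\<alpha> \<otimes> I)\<close>; the row of all words of length \<open>k\<close> has norm at most \<open>\<parallel>[X\<^sub>1, \<dots>, X\<^sub>n]\<parallel>\<^sup>k\<close>, so the \<open>k\<close>-th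
  term is at most \<open>\<surd>a\<^sub>k \<parallel>[X\<^sub>1, \<dots>, X\<^sub>n]\<parallel>\<^sup>k\<close>, and the root test gives (i). For (ii), take orthonormal
  vectors \<open>E\<^sub>\<alpha>\<close> of \<open>H\<close> indexed by the words and let \<open>X\<^sub>i\<close> be \<open>R'\<close> times the left creation operator
  \<open>E\<^sub>\<alpha> \<mapsto> E\<^bsub>i\<alpha>\<^esub>\<close>, extended by \<open>0\<close>. Evaluating the \<open>k\<close>-th term at \<open>x \<otimes> E\<^sub>\<emptyset>\<close> shows that its norm is
  at least \<open>\<surd>a\<^sub>k R'\<^sup>k\<close>, which is at least \<open>1\<close> infinitely often. If two
  radii had both properties, the tuple of (ii) for the smaller one, with norm strictly between them,
  would contradict (i) for the larger one.
\<close>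

section \<open>Adjoints\<close>

lemma bounded_bilinear_cinner: "bounded_bilinear (cinner :: 'a::complex_inner \<Rightarrow> 'a \<Rightarrow> complex)"
proof
  show "\<exists>K. \<forall>a b :: 'a. norm (cinner a b) \<le> norm a * norm b * K"
    by (intro exI[of _ 1]) (simp add: cmod_cinner_le)
qed (simp_all add: cinner_add_left cinner_add_right scaleR_scaleC cinner_scaleC_left
    cinner_scaleC_right scaleR_conv_of_real)

lemma cinner_sum_left: "cinner (\<Sum>i\<in>I. f i) y = (\<Sum>i\<in>I. cinner (f i) y)"
  for f :: "'i \<Rightarrow> 'a::complex_inner"
  by (induction I rule: infinite_finite_induct) (auto simp: cinner_zero_left cinner_add_left)

lemma cinner_sum_right: "cinner y (\<Sum>i\<in>I. f i) = (\<Sum>i\<in>I. cinner y (f i))"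
  for f :: "'i \<Rightarrow> 'a::complex_inner"
  by (induction I rule: infinite_finite_induct) (auto simp: cinner_zero_right cinner_add_right)

lemma norm_power2_cinner: "(norm x)\<^sup>2 = Re (cinner x x)" for x :: "'a::complex_inner"
  by (simp add: cinner_self)

lemma norm_scaleC: "norm (c *\<^sub>C x) = cmod c * norm x" for x :: "'a::complex_inner"
proof -
  have "complex_of_real ((norm (c *\<^sub>C x))\<^sup>2) = c * cnj c * complex_of_real ((norm x)\<^sup>2)"
    by (simp only: cinner_self[symmetric] cinner_scaleC_left cinner_scaleC_right mult_ac)
  also have "\<dots> = complex_of_real ((cmod c * norm x)\<^sup>2)"
    by (simp only: complex_norm_square[symmetric] of_real_mult[symmetric] power_mult_distrib)
  finally have "(norm (c *\<^sub>C x))\<^sup>2 = (cmod c * norm x)\<^sup>2"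
    by (simp only: of_real_eq_iff)
  then show ?thesis by simp
qed

lemma cinner_ext:
  fixes x y :: "'a::complex_inner"
  assumes "\<And>z. cinner z x = cinner z y"
  shows "x = y"
  using assms[of "x - y"] cinner_eq_zero[of "x - y"] by (simp add: cinner_diff_right)

lemma Re_cinner_commute: "Re (cinner x y) = Re (cinner y x)" for x y :: "'a::complex_inner"
  using arg_cong[OF cinner_commute[of x y], of Re] by simp

text \<open>The representing vector minimises \<open>\<parallel>x\<parallel>\<^sup>2 - 2 Re (f x)\<close>; minimising sequences are Cauchy by
  the parallelogram identity.\<close>

lemma riesz_representation:
  fixes f :: "'a::chilbert_space \<Rightarrow> complex"
  assumes bl: "bounded_linear f" and sc: "\<And>c x. f (c *\<^sub>C x) = c * f x"
  shows "\<exists>y. \<forall>x. f x = cinner x y"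
proof -
  interpret f: bounded_linear f by (rule bl)
  define J where "J x = (norm x)\<^sup>2 - 2 * Re (f x)" for x
  obtain K where K: "\<And>x. norm (f x) \<le> norm x * K" using f.bounded by blast
  \<comment> \<open>Completing the square: \<open>J x\<close> is at least
    \<open>(norm x - K)\<^sup>2 - K\<^sup>2\<close>.\<close>
  have lower: "- K\<^sup>2 \<le> J x" for x
  proof -
    have "Re (f x) \<le> norm x * K" using complex_Re_le_cmod[of "f x"] K[of x] by linarith
    moreover have "0 \<le> (norm x - K)\<^sup>2" by simp
    ultimately show ?thesis by (simp add: J_def power2_diff)
  qed
  define m where "m = Inf (range J)"
  have bdd: "bdd_below (range J)" using lower by (intro bdd_belowI[of _ "- K\<^sup>2"]) auto
  have m_le: "m \<le> J x" for x unfolding m_def by (rule cInf_lower) (auto intro: bdd)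
  have "\<exists>x. J x < m + 1 / Suc n" for n
    using cInf_lessD[of "range J" "m + 1 / Suc n"] by (auto simp: m_def)
  then obtain x where x: "\<And>n. J (x n) < m + 1 / Suc n" by metis
  \<comment> \<open>The parallelogram identity, with the value of \<open>J\<close> at the midpoint
    of \<open>u\<close> and \<open>v\<close> bounded below by \<open>m\<close>: near-minimisers lie
    close together.\<close>
  have para: "(norm (u - v))\<^sup>2 \<le> 2 * (J u - m) + 2 * (J v - m)" for u v
  proof -
    have "norm ((1/2) *\<^sub>R (u + v)) = norm (u + v) / 2" by simp
    then have "J ((1/2) *\<^sub>R (u + v)) = (norm (u + v))\<^sup>2 / 4 - (Re (f u) + Re (f v))"
      unfolding J_def f.scaleR f.add by (simp add: power_divide add_divide_distrib)
    moreover have "(norm (u - v))\<^sup>2 = 2 * (norm u)\<^sup>2 + 2 * (norm v)\<^sup>2 - (norm (u + v))\<^sup>2"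
      unfolding norm_power2_cinner cinner_add_left cinner_add_right cinner_diff_left cinner_diff_right
      by simp
    ultimately show ?thesis using m_le[of "(1/2) *\<^sub>R (u + v)"] by (simp add: J_def)
  qed
  have "Cauchy x"
  proof (rule metric_CauchyI)
    fix e :: real assume e: "e > 0"
    obtain N where "4 / e\<^sup>2 < real N" using reals_Archimedean2 by blast
    then have N: "4 / e\<^sup>2 < real (Suc N)" by simp
    have "dist (x p) (x q) < e" if "p \<ge> N" "q \<ge> N" for p q
    proof -
      have le: "J (x j) - m < e\<^sup>2 / 4" if "j \<ge> N" for j
      proof -
        have "1 / real (Suc j) \<le> 1 / real (Suc N)" using that by (simp add: frac_le)
        also have "\<dots> < e\<^sup>2 / 4" using N e by (simp add: field_simps)
        finally show ?thesis using x[of j] by simp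
      qed
      have "(norm (x p - x q))\<^sup>2 < e\<^sup>2"
        using para[of "x p" "x q"] le[OF that(1)] le[OF that(2)] by simp
      then show ?thesis using e by (simp add: dist_norm power2_less_imp_less)
    qed
    then show "\<exists>M. \<forall>p\<ge>M. \<forall>q\<ge>M. dist (x p) (x q) < e" by blast
  qed
  then obtain y where y: "x \<longlonglongrightarrow> y" using Cauchy_convergent convergentD by blast
  have "(\<lambda>n. J (x n)) \<longlonglongrightarrow> J y"
    unfolding J_def by (intro tendsto_intros y f.tendsto)
  moreover have "(\<lambda>n. m + 1 / Suc n) \<longlonglongrightarrow> m + 0"
    by (intro tendsto_intros LIMSEQ_Suc[OF lim_1_over_n])
  ultimately have "J y \<le> m + 0"
    by (rule LIMSEQ_le) (use x in \<open>auto intro!: exI[of _ 0] less_imp_le\<close>)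
  then have min: "J y \<le> J z" for z using m_le[of z] by simp
  have Re_eq: "Re (f z) = Re (cinner z y)" for z
  proof (rule ccontr)
    define d where "d = Re (cinner z y) - Re (f z)"
    assume "Re (f z) \<noteq> Re (cinner z y)"
    then have d: "d \<noteq> 0" by (simp add: d_def)
    \<comment> \<open>Minimality of \<open>y\<close> along the line \<open>y + t z\<close>: the
      increment of \<open>J\<close> is this quadratic in \<open>t\<close>, so its linear coefficient
      has to vanish.\<close>
    have quad: "0 \<le> t\<^sup>2 * (norm z)\<^sup>2 + 2 * t * d" for t
    proof -
      have "(norm (y + t *\<^sub>R z))\<^sup>2 = (norm y)\<^sup>2 + 2 * t * Re (cinner z y) + t\<^sup>2 * (norm z)\<^sup>2"
        unfolding norm_power2_cinner cinner_add_left cinner_add_right scaleR_scaleC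
          cinner_scaleC_left cinner_scaleC_right
        by (simp add: Re_cinner_commute[of y z] power2_eq_square distrib_left)
      moreover have "J (y + t *\<^sub>R z) = (norm (y + t *\<^sub>R z))\<^sup>2 - 2 * Re (f y) - 2 * (t * Re (f z))"
        by (simp add: J_def f.add f.scaleR)
      moreover have "J y = (norm y)\<^sup>2 - 2 * Re (f y)" by (simp add: J_def)
      ultimately have "0 \<le> t\<^sup>2 * (norm z)\<^sup>2 + 2 * t * Re (cinner z y) - 2 * (t * Re (f z))"
        using min[of "y + t *\<^sub>R z"] by linarith
      then show ?thesis by (simp add: d_def right_diff_distrib)
    qed
    \<comment> \<open>Adding \<open>1\<close> keeps \<open>s\<close> positive even for
      \<open>z = 0\<close>. At \<open>t = - d / s\<close> the linear term wins and the quadratic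
      equals \<open>- t\<^sup>2 (s + 1)\<close>.\<close>
    define s where "s = (norm z)\<^sup>2 + 1"
    have s: "s > 0" by (simp add: s_def add_nonneg_pos)
    define t where "t = - d / s"
    have "t * s = - d" using s unfolding t_def by simp
    then have td: "d = - (t * s)" by linarith
    have "t \<noteq> 0" using s d unfolding t_def by simp
    have "0 \<le> t\<^sup>2 * (s - 1) + 2 * t * d" using quad[of t] by (simp add: s_def)
    also have "\<dots> = - (t\<^sup>2 * (s + 1))" unfolding td by algebra
    also have "\<dots> < 0" using s \<open>t \<noteq> 0\<close> by simp
    finally show False by simp
  qed
  \<comment> \<open>The real part at \<open>i z\<close> determines the imaginary part at
    \<open>z\<close>.\<close>
  have "f z = cinner z y" for z
  proof (rule complex_eqI[OF Re_eq])
    show "Im (f z) = Im (cinner z y)"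
      using Re_eq[of "\<i> *\<^sub>C z"] by (simp add: sc cinner_scaleC_left)
  qed
  then show ?thesis by blast
qed

section \<open>Bounded operators and existence of the adjoint\<close>

lemma bop_apply_scaleC: "bop_apply A (c *\<^sub>C x) = c *\<^sub>C bop_apply A x"
  using bop_apply[of A] by blast

lemma bop_apply_add: "bop_apply A (x + y) = bop_apply A x + bop_apply A y"
  using bounded_linear_bop_apply[of A] by (simp add: linear_simps)

lemma bop_apply_sum_right: "bop_apply A (\<Sum>i\<in>I. f i) = (\<Sum>i\<in>I. bop_apply A (f i))"
  using linear_sum[OF bounded_linear.linear[OF bounded_linear_bop_apply[of A]]] .

lemma bop_apply_sum: "bop_apply (\<Sum>i\<in>I. A i) x = (\<Sum>i\<in>I. bop_apply (A i) x)"
  by (induction I rule: infinite_finite_induct) (auto simp: zero_bop.rep_eq plus_bop.rep_eq)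

lemma norm_bop_apply_le: "norm (bop_apply A x) \<le> norm A * norm x"
  unfolding norm_bop.rep_eq by (rule onorm[OF bounded_linear_bop_apply])

lemma norm_bop_le:
  assumes "0 \<le> C" "\<And>x. norm (bop_apply A x) \<le> C * norm x"
  shows "norm A \<le> C"
  unfolding norm_bop.rep_eq using assms by (intro onorm_bound) auto

lemma bop_eqI: "(\<And>x. bop_apply A x = bop_apply B x) \<Longrightarrow> A = B"
  by (simp add: bop_apply_inject[symmetric] fun_eq_iff)

lemma ex_bop:
  fixes f :: "'a::complex_inner \<Rightarrow> 'a"
  assumes "\<And>x y. f (x + y) = f x + f y" "\<And>c x. f (c *\<^sub>C x) = c *\<^sub>C f x"
    "\<And>x. norm (f x) \<le> C * norm x"
  shows "\<exists>B. bop_apply B = f"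
proof -
  have "bounded_linear f"
    using assms by (intro bounded_linear_intro[where K = C]) (simp_all add: scaleR_scaleC mult.commute)
  then show ?thesis using assms(2) Bop_inverse[of f] by blast
qed

text \<open>Norms below are estimated by pairing a vector with itself; this cancels the extra
  factor, also when the vector is \<open>0\<close>.\<close>

lemma norm_le_from_square: "u \<le> C" if "u * u \<le> C * u" "0 \<le> u" "0 \<le> C" for u C :: real
  using that by (cases "u = 0") auto

lemma adj_eqI:
  assumes "\<And>x y. cinner (bop_apply A x) y = cinner x (bop_apply B y)"
  shows "adj A = B"
  unfolding adj_def
proof (rule the_equality)
  fix B' assume "\<forall>x y. cinner (bop_apply A x) y = cinner x (bop_apply B' y)"
  then show "B' = B" using assms by (intro bop_eqI cinner_ext) simp
qed (use assms in blast)

text \<open>Riesz representation gives the value of the adjoint at each \<open>y\<close>. Uniqueness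
  of the representing vector makes these values linear in \<open>y\<close>, and pairing
  \<open>g x\<close> with itself bounds them.\<close>

lemma ex_adj: "\<exists>B. \<forall>x y. cinner (bop_apply A x) y = cinner x (bop_apply B y)"
  for A :: "'a::chilbert_space bop"
proof -
  have "\<exists>z. \<forall>x. cinner (bop_apply A x) y = cinner x z" for y
  proof (rule riesz_representation)
    show "bounded_linear (\<lambda>x. cinner (bop_apply A x) y)"
      by (rule bounded_linear_compose[OF
            bounded_bilinear.bounded_linear_left[OF bounded_bilinear_cinner] bounded_linear_bop_apply])
  qed (simp add: bop_apply_scaleC cinner_scaleC_left)
  then obtain g where g: "\<And>x y. cinner (bop_apply A x) y = cinner x (g y)" by metis
  have "\<exists>B. bop_apply B = g"
  proof (rule ex_bop)
    show "g (x + y) = g x + g y" for x y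
      by (rule cinner_ext) (simp add: g[symmetric] cinner_add_right)
    show "g (c *\<^sub>C x) = c *\<^sub>C g x" for c x
      by (rule cinner_ext) (simp add: g[symmetric] cinner_scaleC_right)
    show "norm (g x) \<le> norm A * norm x" for x
    proof (rule norm_le_from_square)
      have "norm (g x) * norm (g x) = cmod (cinner (bop_apply A (g x)) x)"
        by (simp add: g cinner_self power2_eq_square norm_mult)
      also have "\<dots> \<le> norm (bop_apply A (g x)) * norm x" by (rule cmod_cinner_le)
      also have "\<dots> \<le> norm A * norm (g x) * norm x"
        by (intro mult_right_mono norm_bop_apply_le) simp
      finally show "norm (g x) * norm (g x) \<le> norm A * norm x * norm (g x)" by (simp add: mult_ac)
    qed simp_all
  qed
  then show ?thesis using g by metis
qed

lemma cinner_adj: "cinner (bop_apply A x) y = cinner x (bop_apply (adj A) y)"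
  using ex_adj[of A] adj_eqI[of A] by metis

lemma adj_adj: "adj (adj A) = A"
proof (rule adj_eqI)
  show "cinner (bop_apply (adj A) x) y = cinner x (bop_apply A y)" for x y
    using cinner_commute[of "bop_apply (adj A) x" y] cinner_commute[of x "bop_apply A y"]
    by (simp add: cinner_adj)
qed

section \<open>Columns of operators\<close>

lemma cinner_sum_adj_mult:
  "cinner (bop_apply (\<Sum>i\<in>I. adj (A i) * A i) x) y
    = (\<Sum>i\<in>I. cinner (bop_apply (A i) x) (bop_apply (A i) y))"
  by (simp add: bop_apply_sum cinner_sum_left times_bop.rep_eq cinner_adj adj_adj)

text \<open>For the column \<open>C\<close> of the \<open>A i\<close>, the operator on the right is
  \<open>C\<^sup>* C\<close>, whose quadratic form at \<open>x\<close> is the squared norm of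
  \<open>C x\<close>.\<close>

lemma sum_norm_apply_power2_le:
  "(\<Sum>i\<in>I. (norm (bop_apply (A i) x))\<^sup>2) \<le> norm (\<Sum>i\<in>I. adj (A i) * A i) * (norm x)\<^sup>2"
proof -
  let ?S = "\<Sum>i\<in>I. adj (A i) * A i"
  have "(\<Sum>i\<in>I. (norm (bop_apply (A i) x))\<^sup>2) = Re (cinner (bop_apply ?S x) x)"
    by (simp add: cinner_sum_adj_mult norm_power2_cinner)
  also have "\<dots> \<le> norm (bop_apply ?S x) * norm x"
    using complex_Re_le_cmod cmod_cinner_le order_trans by blast
  also have "\<dots> \<le> norm ?S * norm x * norm x" by (intro mult_right_mono norm_bop_apply_le) simp
  finally show ?thesis by (simp add: power2_eq_square mult.assoc)
qed

text \<open>The converse bound for the column \<open>C\<close>: if \<open>y = C\<^sup>* C x\<close>,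
  then \<open>(norm y)\<^sup>2\<close> is the inner product of \<open>C x\<close> and
  \<open>C y\<close>, and Cauchy-Schwarz applies.\<close>

lemma norm_sum_adj_mult_le:
  assumes "0 \<le> C" "\<And>x. (\<Sum>i\<in>I. (norm (bop_apply (A i) x))\<^sup>2) \<le> C * (norm x)\<^sup>2"
  shows "norm (\<Sum>i\<in>I. adj (A i) * A i) \<le> C"
proof (rule norm_bop_le[OF assms(1)])
  fix x
  define y where "y = bop_apply (\<Sum>i\<in>I. adj (A i) * A i) x"
  have L2: "L2_set (\<lambda>i. norm (bop_apply (A i) z)) I \<le> sqrt C * norm z" for z
    using real_sqrt_le_mono[OF assms(2)[of z]] by (simp add: L2_set_def real_sqrt_mult)
  have "norm y * norm y = cmod (cinner y y)" by (simp add: cinner_self power2_eq_square norm_mult)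
  also have "\<dots> = cmod (\<Sum>i\<in>I. cinner (bop_apply (A i) x) (bop_apply (A i) y))"
    by (subst y_def) (simp only: cinner_sum_adj_mult)
  also have "\<dots> \<le> (\<Sum>i\<in>I. \<bar>norm (bop_apply (A i) x)\<bar> * \<bar>norm (bop_apply (A i) y)\<bar>)"
    by (rule sum_norm_le) (simp add: cmod_cinner_le)
  also have "\<dots> \<le> L2_set (\<lambda>i. norm (bop_apply (A i) x)) I * L2_set (\<lambda>i. norm (bop_apply (A i) y)) I"
    by (rule L2_set_mult_ineq)
  also have "\<dots> \<le> (sqrt C * norm x) * (sqrt C * norm y)"
    by (intro mult_mono L2 L2_set_nonneg) (simp add: assms(1))
  also have "\<dots> = (sqrt C * sqrt C) * norm x * norm y" by (simp only: mult_ac)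
  also have "\<dots> = C * norm x * norm y" using assms(1) by simp
  finally have "norm y * norm y \<le> C * norm x * norm y" .
  then show "norm (bop_apply (\<Sum>i\<in>I. adj (A i) * A i) x) \<le> C * norm x"
    unfolding y_def[symmetric] by (rule norm_le_from_square) (simp_all add: assms(1))
qed

section \<open>Norm estimates on the algebraic tensor product\<close>

text \<open>\<open>p\<close> is the projection of \<open>x\<close> onto the span of the
  \<open>e i\<close>, and the squared norm of \<open>x - p\<close> is the difference of the two
  sides.\<close>

lemma bessel_inequality:
  fixes e :: "'i \<Rightarrow> 'a::complex_inner"
  assumes I: "finite I"
    and on: "\<And>i j. i \<in> I \<Longrightarrow> j \<in> I \<Longrightarrow> cinner (e i) (e j) = (if i = j then 1 else 0)"
  shows "(\<Sum>i\<in>I. (cmod (cinner x (e i)))\<^sup>2) \<le> (norm x)\<^sup>2"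
proof -
  define p where "p = (\<Sum>i\<in>I. cinner x (e i) *\<^sub>C e i)"
  define s where "s = (\<Sum>i\<in>I. (cmod (cinner x (e i)))\<^sup>2)"
  have pe: "cinner p (e j) = cinner x (e j)" if "j \<in> I" for j
  proof -
    have "cinner p (e j) = (\<Sum>i\<in>I. cinner x (e i) * cinner (e i) (e j))"
      by (simp add: p_def cinner_sum_left cinner_scaleC_left)
    also have "\<dots> = (\<Sum>i\<in>I. if i = j then cinner x (e i) else 0)"
      using that by (intro sum.cong) (auto simp: on)
    finally show ?thesis using I that by simp
  qed
  have sum: "(\<Sum>i\<in>I. cinner x (e i) * cnj (cinner x (e i))) = complex_of_real s"
    unfolding s_def of_real_sum by (intro sum.cong refl) (simp only: complex_norm_square)
  have xp: "cinner x p = complex_of_real s"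
    by (simp add: p_def cinner_sum_right cinner_scaleC_right sum mult.commute)
  have pp: "cinner p p = complex_of_real s"
  proof -
    have "cinner p p = (\<Sum>i\<in>I. cnj (cinner x (e i)) * cinner p (e i))"
      by (subst (2) p_def) (simp add: cinner_sum_right cinner_scaleC_right)
    also have "\<dots> = (\<Sum>i\<in>I. cinner x (e i) * cnj (cinner x (e i)))"
      by (intro sum.cong refl) (simp add: pe mult.commute)
    finally show ?thesis by (simp only: sum)
  qed
  have px: "cinner p x = complex_of_real s" using cinner_commute[of p x] xp by simp
  have "0 \<le> Re (cinner (x - p) (x - p))" by (rule cinner_ge_zero)
  also have "\<dots> = (norm x)\<^sup>2 - s"
    unfolding cinner_diff_left cinner_diff_right xp pp px norm_power2_cinner by simp
  finally show ?thesis by (simp add: s_def)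
qed

lemma norm_power2_sum_orthonormal:
  fixes e :: "'i \<Rightarrow> 'a::complex_inner"
  assumes I: "finite I"
    and on: "\<And>i j. i \<in> I \<Longrightarrow> j \<in> I \<Longrightarrow> cinner (e i) (e j) = (if i = j then 1 else 0)"
  shows "(norm (\<Sum>i\<in>I. c i *\<^sub>C e i))\<^sup>2 = (\<Sum>i\<in>I. (cmod (c i))\<^sup>2)"
proof -
  have "cinner (\<Sum>i\<in>I. c i *\<^sub>C e i) (\<Sum>i\<in>I. c i *\<^sub>C e i)
      = (\<Sum>i\<in>I. cnj (c i) * (\<Sum>j\<in>I. c j * cinner (e j) (e i)))"
    by (simp add: cinner_sum_left cinner_sum_right cinner_scaleC_left cinner_scaleC_right)
  also have "\<dots> = (\<Sum>i\<in>I. cnj (c i) * (\<Sum>j\<in>I. if j = i then c j else 0))"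
    by (intro sum.cong refl arg_cong2[where f = "(*)"]) (auto simp: on)
  also have "\<dots> = (\<Sum>i\<in>I. complex_of_real ((cmod (c i))\<^sup>2))"
    using I by (intro sum.cong refl) (simp add: complex_norm_square mult.commute del: of_real_power)
  finally have "complex_of_real ((norm (\<Sum>i\<in>I. c i *\<^sub>C e i))\<^sup>2)
      = complex_of_real (\<Sum>i\<in>I. (cmod (c i))\<^sup>2)"
    by (simp only: cinner_self of_real_sum)
  then show ?thesis by (simp only: of_real_eq_iff)
qed

section \<open>Orthonormal representations of algebraic tensors\<close>

lemma cinner_atensor_of_right: "cinner s (atensor_of w) = (\<Sum>(c, d)\<leftarrow>w. atensor_form s c d)"
  by (simp add: cinner_atensor_def atensor_cinner_atensor_of)

lemma cinner_atensor_upt: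
  "cinner s (atensor_of (map (\<lambda>k. (c k, d k)) [0..<n])) = (\<Sum>k<n. atensor_form s (c k) (d k))"
  by (simp add: cinner_atensor_of_right comp_def interv_sum_list_conv_sum_set_nat atLeast0LessThan)

lemma tensor_form_upt:
  "tensor_form (map (\<lambda>k. (c k, d k)) [0..<n]) x y = (\<Sum>k<n. cinner (c k) x * cinner (d k) y)"
  by (simp add: tensor_form_def comp_def interv_sum_list_conv_sum_set_nat atLeast0LessThan)

lemma atensor_form_upt:
  "atensor_form (atensor_of (map (\<lambda>k. (c k, d k)) [0..<n])) x y
    = (\<Sum>k<n. cinner (c k) x * cinner (d k) y)"
  by (simp only: atensor_of.rep_eq tensor_form_upt)

text \<open>Gram-Schmidt in the right factors, already available for forms, is transported to
  tensors; orthonormality removes the cross terms of \<open>cinner t t\<close>.\<close>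

lemma atensor_right_orthonormal:
  fixes t :: "('a::complex_inner, 'b::complex_inner) atensor"
  obtains n :: nat and c e where "t = atensor_of (map (\<lambda>k. (c k, e k)) [0..<n])"
    and "\<forall>j<n. \<forall>k<n. cinner (e j) (e k) = (if j = k then 1 else 0)"
    and "(norm t)\<^sup>2 = (\<Sum>k<n. (norm (c k))\<^sup>2)"
proof -
  obtain w where w: "t = atensor_of w" using ex_atensor_of by blast
  obtain n :: nat and c :: "nat \<Rightarrow> 'a" and e :: "nat \<Rightarrow> 'b" where
    f: "tensor_form w = (\<lambda>x y. \<Sum>k<n. cinner (c k) x * cinner (e k) y)" and
    on: "\<And>j k. j < n \<Longrightarrow> k < n \<Longrightarrow> cinner (e j) (e k) = (if j = k then 1 else 0)"
    using atensor_orthonormal_representation[of w] by auto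
  have t: "t = atensor_of (map (\<lambda>k. (c k, e k)) [0..<n])"
    unfolding w atensor_form_inject[symmetric] by (intro ext) (simp only: tensor_form_upt atensor_of.rep_eq f)
  have "cinner t t = (\<Sum>k<n. \<Sum>j<n. cinner (c j) (c k) * cinner (e j) (e k))"
    by (simp add: t cinner_atensor_upt atensor_form_upt)
  also have "\<dots> = (\<Sum>k<n. \<Sum>j<n. if j = k then cinner (c j) (c k) else 0)"
    by (intro sum.cong) (auto simp: on)
  also have "\<dots> = (\<Sum>k<n. cinner (c k) (c k))"
    by (intro sum.cong refl) simp
  finally have "(norm t)\<^sup>2 = (\<Sum>k<n. (norm (c k))\<^sup>2)"
    unfolding norm_power2_cinner by simp
  then show ?thesis using that t on by blast
qed

text \<open>Swapping the factors of \<open>w\<close> transposes its form, so this is the right-hand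
  representation of the swapped list.\<close>

lemma atensor_left_orthonormal:
  fixes t :: "('a::complex_inner, 'b::complex_inner) atensor"
  obtains n :: nat and e d where "t = atensor_of (map (\<lambda>k. (e k, d k)) [0..<n])"
    and "\<forall>j<n. \<forall>k<n. cinner (e j) (e k) = (if j = k then 1 else 0)"
    and "(norm t)\<^sup>2 = (\<Sum>k<n. (norm (d k))\<^sup>2)"
proof -
  obtain w where w: "t = atensor_of w" using ex_atensor_of by blast
  obtain n :: nat and d :: "nat \<Rightarrow> 'b" and e :: "nat \<Rightarrow> 'a" where
    f: "tensor_form (map prod.swap w) = (\<lambda>x y. \<Sum>k<n. cinner (d k) x * cinner (e k) y)" and
    on: "\<And>j k. j < n \<Longrightarrow> k < n \<Longrightarrow> cinner (e j) (e k) = (if j = k then 1 else 0)"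
    using atensor_orthonormal_representation[of "map prod.swap w"] by auto
  have swap: "tensor_form w x y = tensor_form (map prod.swap w) y x" for x y
    by (simp add: tensor_form_def comp_def split_def mult.commute)
  have t: "t = atensor_of (map (\<lambda>k. (e k, d k)) [0..<n])"
    unfolding w atensor_form_inject[symmetric]
    by (intro ext) (simp only: tensor_form_upt atensor_of.rep_eq swap f mult.commute)
  have "cinner t t = (\<Sum>k<n. \<Sum>j<n. cinner (d j) (d k) * cinner (e j) (e k))"
    by (simp add: t cinner_atensor_upt atensor_form_upt mult.commute)
  also have "\<dots> = (\<Sum>k<n. \<Sum>j<n. if j = k then cinner (d j) (d k) else 0)"
    by (intro sum.cong) (auto simp: on)
  also have "\<dots> = (\<Sum>k<n. cinner (d k) (d k))"
    by (intro sum.cong refl) simp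
  finally have "(norm t)\<^sup>2 = (\<Sum>k<n. (norm (d k))\<^sup>2)"
    unfolding norm_power2_cinner by simp
  then show ?thesis using that t on by blast
qed

text \<open>This is \<open>A \<otimes> X\<close> on the algebraic tensor product. A tensor is the
  form of its inner products with simple tensors, so the operators act through their adjoints on the
  arguments, and no representation has to be chosen.\<close>

lift_definition map_atensor ::
    "'a::chilbert_space bop \<Rightarrow> 'b::chilbert_space bop \<Rightarrow> ('a, 'b) atensor \<Rightarrow> ('a, 'b) atensor"
  is "\<lambda>A X f c d. f (bop_apply (adj A) c) (bop_apply (adj X) d)"
proof -
  fix A :: "'a bop" and X :: "'b bop" and f :: "'a \<Rightarrow> 'b \<Rightarrow> complex"
  assume "f \<in> range tensor_form"
  then obtain w where "f = tensor_form w" by blast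
  then have "(\<lambda>c d. f (bop_apply (adj A) c) (bop_apply (adj X) d))
      = tensor_form (map (map_prod (bop_apply A) (bop_apply X)) w)"
    by (simp add: tensor_form_def comp_def split_def cinner_adj)
  then show "(\<lambda>c d. f (bop_apply (adj A) c) (bop_apply (adj X) d)) \<in> range tensor_form"
    by (rule range_eqI)
qed

lemma map_atensor_add: "map_atensor A X (s + t) = map_atensor A X s + map_atensor A X t"
  by (simp add: atensor_form_inject[symmetric] map_atensor.rep_eq plus_atensor.rep_eq)

lemma map_atensor_scaleC: "map_atensor A X (c *\<^sub>C t) = c *\<^sub>C map_atensor A X t"
  by (simp add: atensor_form_inject[symmetric] map_atensor.rep_eq scaleC_atensor.rep_eq)

lemma map_atensor_simple: "map_atensor A X (atensor_of [(a, b)])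
    = atensor_of [(bop_apply A a, bop_apply X b)]"
  by (simp add: atensor_form_inject[symmetric] map_atensor.rep_eq atensor_of.rep_eq tensor_form_def
      cinner_adj)

lemma atensor_form_sum: "atensor_form (\<Sum>i\<in>I. t i) x y = (\<Sum>i\<in>I. atensor_form (t i) x y)"
  by (induction I rule: infinite_finite_induct) (auto simp: zero_atensor.rep_eq plus_atensor.rep_eq)

text \<open>
  The image \<open>s\<close> of \<open>t\<close> is estimated through \<open>\<langle>s, s\<rangle>\<close>, where the argument \<open>t\<close> is written with orthonormal
  right factors and the test vector \<open>s\<close> with orthonormal left factors; Bessel's inequality then
  separates the column and the row.
\<close>

lemma norm_sum_map_atensor_le:
  fixes A :: "'i \<Rightarrow> 'a::chilbert_space bop" and X :: "'i \<Rightarrow> 'b::chilbert_space bop"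
  assumes I: "finite I" and a: "0 \<le> a" and r: "0 \<le> r"
    and col: "\<And>x. (\<Sum>i\<in>I. (norm (bop_apply (A i) x))\<^sup>2) \<le> a\<^sup>2 * (norm x)\<^sup>2"
    and row: "\<And>h. (norm (\<Sum>i\<in>I. bop_apply (X i) (h i)))\<^sup>2 \<le> r\<^sup>2 * (\<Sum>i\<in>I. (norm (h i))\<^sup>2)"
  shows "norm (\<Sum>i\<in>I. map_atensor (A i) (X i) t) \<le> a * r * norm t"
proof -
  define s where "s = (\<Sum>i\<in>I. map_atensor (A i) (X i) t)"
  obtain n c e where t: "t = atensor_of (map (\<lambda>k. (c k, e k)) [0..<n])"
    and e: "\<forall>j<n. \<forall>k<n. cinner (e j) (e k) = (if j = k then 1 else 0)"
    and nt: "(norm t)\<^sup>2 = (\<Sum>k<n. (norm (c k))\<^sup>2)"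
    by (rule atensor_right_orthonormal[of t])
  obtain m f g where s: "s = atensor_of (map (\<lambda>l. (f l, g l)) [0..<m])"
    and f: "\<forall>j<m. \<forall>k<m. cinner (f j) (f k) = (if j = k then 1 else 0)"
    and ns: "(norm s)\<^sup>2 = (\<Sum>l<m. (norm (g l))\<^sup>2)"
    by (rule atensor_left_orthonormal[of s])
  \<comment> \<open>\<open>h l i\<close> is \<open>(A i \<otimes> I) t\<close> with its left factor
    contracted against \<open>f l\<close>, and \<open>v l\<close> is the same contraction of
    \<open>s\<close>.\<close>
  define h where "h l i = (\<Sum>k<n. cinner (bop_apply (A i) (c k)) (f l) *\<^sub>C e k)" for l i
  define v where "v l = (\<Sum>i\<in>I. bop_apply (X i) (h l i))" for l
  have "cinner s s = (\<Sum>l<m. atensor_form s (f l) (g l))"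
    by (subst (2) s) (rule cinner_atensor_upt)
  also have "\<dots> = (\<Sum>l<m. cinner (v l) (g l))"
  proof (intro sum.cong refl)
    fix l
    have "atensor_form s (f l) (g l)
        = (\<Sum>i\<in>I. \<Sum>k<n. cinner (bop_apply (A i) (c k)) (f l) * cinner (bop_apply (X i) (e k)) (g l))"
      by (simp add: s_def atensor_form_sum map_atensor.rep_eq t atensor_form_upt cinner_adj)
    also have "\<dots> = cinner (v l) (g l)"
      by (simp add: v_def h_def bop_apply_sum_right bop_apply_scaleC cinner_sum_left cinner_scaleC_left)
    finally show "atensor_form s (f l) (g l) = cinner (v l) (g l)" .
  qed
  finally have ss: "cinner s s = (\<Sum>l<m. cinner (v l) (g l))" .
  define F where "F l i k = (cmod (cinner (bop_apply (A i) (c k)) (f l)))\<^sup>2" for l i k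
  have norm_h: "(norm (h l i))\<^sup>2 = (\<Sum>k<n. F l i k)" for l i
    unfolding h_def F_def by (rule norm_power2_sum_orthonormal) (use e in auto)
  \<comment> \<open>The sum over \<open>l\<close> is moved inside, so that Bessel for the
    orthonormal \<open>f\<close> comes first and the column bound for each fixed \<open>c k\<close>
    second.\<close>
  have "(\<Sum>l<m. \<Sum>i\<in>I. \<Sum>k<n. F l i k) = (\<Sum>l<m. \<Sum>k<n. \<Sum>i\<in>I. F l i k)"
    by (intro sum.cong refl) (rule sum.swap)
  also have "\<dots> = (\<Sum>k<n. \<Sum>l<m. \<Sum>i\<in>I. F l i k)" by (rule sum.swap)
  also have "\<dots> = (\<Sum>k<n. \<Sum>i\<in>I. \<Sum>l<m. F l i k)"
    by (intro sum.cong refl) (rule sum.swap)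
  finally have swap: "(\<Sum>l<m. \<Sum>i\<in>I. \<Sum>k<n. F l i k) = (\<Sum>k<n. \<Sum>i\<in>I. \<Sum>l<m. F l i k)" .
  have "(\<Sum>l<m. (norm (v l))\<^sup>2) \<le> (\<Sum>l<m. r\<^sup>2 * (\<Sum>i\<in>I. (norm (h l i))\<^sup>2))"
    unfolding v_def by (intro sum_mono row)
  also have "\<dots> = r\<^sup>2 * (\<Sum>k<n. \<Sum>i\<in>I. \<Sum>l<m. F l i k)"
    by (simp only: norm_h sum_distrib_left[symmetric] swap)
  also have "\<dots> \<le> r\<^sup>2 * (\<Sum>k<n. \<Sum>i\<in>I. (norm (bop_apply (A i) (c k)))\<^sup>2)"
    unfolding F_def by (intro mult_left_mono sum_mono bessel_inequality) (use f in auto)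
  also have "\<dots> \<le> r\<^sup>2 * (\<Sum>k<n. a\<^sup>2 * (norm (c k))\<^sup>2)"
    by (intro mult_left_mono sum_mono col) auto
  also have "\<dots> = (a * r * norm t)\<^sup>2"
    unfolding power_mult_distrib nt by (simp add: sum_distrib_left mult_ac)
  finally have v: "L2_set (\<lambda>l. norm (v l)) {..<m} \<le> a * r * norm t"
    unfolding L2_set_def using a r by (intro real_le_lsqrt sum_nonneg) auto
  have "norm s * norm s = cmod (cinner s s)" by (simp add: cinner_self power2_eq_square norm_mult)
  also have "\<dots> \<le> (\<Sum>l<m. \<bar>norm (v l)\<bar> * \<bar>norm (g l)\<bar>)"
    unfolding ss by (rule sum_norm_le) (simp add: cmod_cinner_le)
  also have "\<dots> \<le> L2_set (\<lambda>l. norm (v l)) {..<m} * L2_set (\<lambda>l. norm (g l)) {..<m}"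
    by (rule L2_set_mult_ineq)
  also have "\<dots> \<le> (a * r * norm t) * norm s"
    by (rule mult_mono[OF v]) (use a r in \<open>simp_all add: L2_set_def ns[symmetric] L2_set_nonneg\<close>)
  finally have "norm s \<le> a * r * norm t" by (rule norm_le_from_square) (simp_all add: a r)
  then show ?thesis by (simp only: s_def)
qed

section \<open>Tensor products of operators and convergence inside\<close>

lemma to_completion_zero: "to_completion 0 = 0"
  using norm_to_completion[of 0] by simp

lemma to_completion_sum: "to_completion (\<Sum>i\<in>I. f i) = (\<Sum>i\<in>I. to_completion (f i))"
  by (induction I rule: infinite_finite_induct) (simp_all add: to_completion_zero to_completion_add)

lemma continuous_on_bop_apply: "continuous_on S (bop_apply A)"
  by (rule linear_continuous_on[OF bounded_linear_bop_apply])

lemma norm_bop_completion_le: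
  assumes "0 \<le> C" "\<And>x. norm (bop_apply T (to_completion x)) \<le> C * norm x"
  shows "norm T \<le> C"
proof (rule norm_bop_le[OF assms(1)])
  show "norm (bop_apply T x) \<le> C * norm x" for x
  proof (induction x rule: completion_induct)
    case 1
    show ?case by (intro closed_Collect_le continuous_intros continuous_on_bop_apply)
  qed (simp only: norm_to_completion assms(2))
qed

lemma bop_completion_eqI:
  assumes "\<And>x. bop_apply S (to_completion x) = bop_apply T (to_completion x)"
  shows "S = T"
proof (rule bop_eqI)
  show "bop_apply S x = bop_apply T x" for x
  proof (induction x rule: completion_induct)
    case 1
    show ?case by (intro closed_Collect_eq continuous_intros continuous_on_bop_apply)
  qed (rule assms)
qed

text \<open>The map is Lipschitz on the dense image of \<open>to_completion\<close> and so extends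
  continuously to the completion; both linearity and the bound are closed conditions and carry over
  by density.\<close>

lemma ex_bop_completion:
  fixes f :: "'a::complex_inner \<Rightarrow> 'a completion"
  assumes add: "\<And>x y. f (x + y) = f x + f y" and scale: "\<And>c x. f (c *\<^sub>C x) = c *\<^sub>C f x"
    and bound: "\<And>x. norm (f x) \<le> C * norm x"
  shows "\<exists>T. \<forall>x. bop_apply T (to_completion x) = f x"
proof -
  have diff: "f x - f y = f (x - y)" for x y using add[of "x - y" y] by simp
  have inj: "inj (to_completion :: 'a \<Rightarrow> 'a completion)"
  proof (rule injI)
    fix x y :: 'a assume "to_completion x = to_completion y"
    then show "x = y" using norm_to_completion[of "x - y"] by (simp add: to_completion_diff)
  qed
  define h where "h = f \<circ> inv to_completion"
  have h: "h (to_completion x) = f x" for x by (simp add: h_def inv_f_f[OF inj])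
  have "uniformly_continuous_on (range to_completion) h"
    unfolding uniformly_continuous_on_def
  proof (intro allI impI)
    fix e :: real assume e: "e > 0"
    \<comment> \<open>The modulus uses \<open>\<bar>C\<bar> + 1\<close> because \<open>C\<close>
      itself might be zero or negative.\<close>
    have "dist (h u) (h v) < e"
      if uv: "u \<in> range to_completion" "v \<in> range to_completion" "dist u v < e / (\<bar>C\<bar> + 1)" for u v
    proof -
      obtain x y where u: "u = to_completion x" and v: "v = to_completion y" using uv by blast
      have "dist (h u) (h v) \<le> C * norm (x - y)"
        using bound[of "x - y"] by (simp add: u v h dist_norm diff)
      also have "\<dots> \<le> (\<bar>C\<bar> + 1) * norm (x - y)" by (intro mult_right_mono) auto
      also have "norm (x - y) = dist u v"
        by (simp only: u v dist_norm norm_to_completion to_completion_diff[symmetric])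
      also have "(\<bar>C\<bar> + 1) * dist u v < e" using uv(3) by (simp add: pos_less_divide_eq mult.commute)
      finally show ?thesis .
    qed
    then show "\<exists>d>0. \<forall>x\<in>range to_completion. \<forall>x'\<in>range to_completion. dist x' x < d \<longrightarrow> dist (h x') (h x) < e"
      using e by (intro exI[of _ "e / (\<bar>C\<bar> + 1)"]) auto
  qed
  then obtain g where "uniformly_continuous_on (closure (range to_completion)) g"
    and g: "\<And>x. x \<in> range to_completion \<Longrightarrow> h x = g x"
    by (rule uniformly_continuous_on_extension_on_closure) blast
  then have cont: "continuous_on UNIV g"
    using uniformly_continuous_imp_continuous by (simp add: closure_range_to_completion)
  have cont': "continuous_on UNIV (\<lambda>x. g (k x))" if "continuous_on UNIV k" for k
    using continuous_on_compose2[OF cont that] by simp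
  have gf: "g (to_completion x) = f x" for x using g[of "to_completion x"] by (simp add: h)
  have "\<exists>T. bop_apply T = g"
  proof (rule ex_bop)
    show "g (x + y) = g x + g y" for x y
    proof (induction x rule: completion_induct)
      case 1 show ?case by (intro closed_Collect_eq continuous_intros cont')
    next
      case (2 x)
      show ?case
      proof (induction y rule: completion_induct)
        case 1 show ?case by (intro closed_Collect_eq continuous_intros cont')
      next
        case (2 y)
        show ?case by (simp only: to_completion_add[symmetric] gf add)
      qed
    qed
    show "g (c *\<^sub>C x) = c *\<^sub>C g x" for c x
    proof (induction x rule: completion_induct)
      case 1 show ?case by (intro closed_Collect_eq continuous_intros cont')
    qed (simp only: to_completion_scaleC[symmetric] gf scale)
    show "norm (g x) \<le> C * norm x" for x
    proof (induction x rule: completion_induct)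
      case 1 show ?case by (intro closed_Collect_le continuous_intros cont')
    qed (simp only: norm_to_completion gf bound)
  qed
  then obtain T where "bop_apply T = g" by blast
  then have "\<forall>x. bop_apply T (to_completion x) = f x" by (simp add: gf)
  then show ?thesis by blast
qed

lemma to_completion_atensor_of: "to_completion (atensor_of w) = (\<Sum>(a, b)\<leftarrow>w. a \<otimes> b)"
proof (induction w)
  case Nil
  have "atensor_of [] = (0 :: ('a, 'b) atensor)"
    by (simp add: atensor_form_inject[symmetric] atensor_of.rep_eq zero_atensor.rep_eq tensor_form_Nil)
  then show ?case by (simp add: to_completion_zero)
next
  case (Cons p w)
  obtain a b where p: "p = (a, b)" by force
  have "atensor_of (p # w) = atensor_of [(a, b)] + (atensor_of w :: ('a, 'b) atensor)"
    by (simp add: p atensor_form_inject[symmetric] atensor_of.rep_eq plus_atensor.rep_eq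
        tensor_form_Cons tensor_form_Nil)
  then show ?case using Cons by (simp add: p tensor_def to_completion_add)
qed

text \<open>Justifies the definite description in \<open>tensor_bop\<close>: the continuous
  extension of \<open>map_atensor A X\<close> has the required values, and two candidates agree on
  sums of simple tensors, which are dense.\<close>

lemma tensor_bop_to_completion:
  "bop_apply (A \<otimes>\<^sub>o X) (to_completion t) = to_completion (map_atensor A X t)"
proof -
  \<comment> \<open>A single operator pair is a column and a row with one entry.\<close>
  have "norm (to_completion (map_atensor A X t)) \<le> norm A * norm X * norm t" for t
    using norm_sum_map_atensor_le[of "{()}" "norm A" "norm X" "\<lambda>_. A" "\<lambda>_. X" t]
      power_mono[OF norm_bop_apply_le[of A], of _ 2] power_mono[OF norm_bop_apply_le[of X], of _ 2]
    by (simp add: norm_to_completion power_mult_distrib)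
  then have "\<exists>T. \<forall>t. bop_apply T (to_completion t) = to_completion (map_atensor A X t)"
    by (intro ex_bop_completion[where C = "norm A * norm X"])
      (simp_all add: map_atensor_add map_atensor_scaleC to_completion_add to_completion_scaleC)
  then obtain T where T: "\<And>t. bop_apply T (to_completion t) = to_completion (map_atensor A X t)"
    by blast
  have simple: "bop_apply T (a \<otimes> b) = bop_apply A a \<otimes> bop_apply X b" for a b
    by (simp add: tensor_def T map_atensor_simple)
  have "A \<otimes>\<^sub>o X = T"
    unfolding tensor_bop_def
  proof (rule the_equality)
    fix S assume S: "\<forall>a b. bop_apply S (a \<otimes> b) = bop_apply A a \<otimes> bop_apply X b"
    have "bop_apply S (to_completion (atensor_of w)) = bop_apply T (to_completion (atensor_of w))" for w
    proof (induction w)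
      case Nil
      show ?case using bounded_linear_bop_apply[of S] bounded_linear_bop_apply[of T]
        by (simp add: to_completion_atensor_of linear_simps)
    next
      case (Cons p w)
      then show ?case by (simp add: to_completion_atensor_of split_def bop_apply_add S simple)
    qed
    then have "bop_apply S (to_completion t) = bop_apply T (to_completion t)" for t
      using ex_atensor_of[of t] by auto
    then show "S = T" by (rule bop_completion_eqI)
  qed (simp add: simple)
  then show ?thesis by (simp only: T)
qed

lemma tensor_bop_tensor: "bop_apply (A \<otimes>\<^sub>o X) (a \<otimes> b) = bop_apply A a \<otimes> bop_apply X b"
  by (simp add: tensor_def tensor_bop_to_completion map_atensor_simple)

lemma norm_tensor: "norm (a \<otimes> b) = norm a * norm b"
proof -
  have "complex_of_real ((norm (a \<otimes> b))\<^sup>2) = complex_of_real ((norm a * norm b)\<^sup>2)"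
    by (simp only: cinner_self[symmetric] cinner_tensor)
      (simp only: cinner_self of_real_mult[symmetric] power_mult_distrib)
  then have "(norm (a \<otimes> b))\<^sup>2 = (norm a * norm b)\<^sup>2" by (simp only: of_real_eq_iff)
  then show ?thesis by simp
qed

lemma norm_sum_tensor_bop_le:
  fixes A :: "'i \<Rightarrow> 'a::chilbert_space bop" and X :: "'i \<Rightarrow> 'b::chilbert_space bop"
  assumes I: "finite I" and a: "0 \<le> a" and r: "0 \<le> r"
    and col: "\<And>x. (\<Sum>i\<in>I. (norm (bop_apply (A i) x))\<^sup>2) \<le> a\<^sup>2 * (norm x)\<^sup>2"
    and row: "\<And>h. (norm (\<Sum>i\<in>I. bop_apply (X i) (h i)))\<^sup>2 \<le> r\<^sup>2 * (\<Sum>i\<in>I. (norm (h i))\<^sup>2)"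
  shows "norm (\<Sum>i\<in>I. A i \<otimes>\<^sub>o X i) \<le> a * r"
proof (rule norm_bop_completion_le)
  fix t
  show "norm (bop_apply (\<Sum>i\<in>I. A i \<otimes>\<^sub>o X i) (to_completion t)) \<le> a * r * norm t"
    using norm_sum_map_atensor_le[OF assms, of t]
    by (simp only: bop_apply_sum tensor_bop_to_completion to_completion_sum[symmetric] norm_to_completion)
qed (use a r in simp)

section \<open>Rows of operators and of words\<close>

lemma bounded_linear_row: "bounded_linear (\<lambda>v :: 'h::chilbert_space ^ 'n::finite. \<Sum>i\<in>UNIV. bop_apply (X i) (v $ i))"
  by (intro bounded_linear_sum bounded_linear_compose[OF bounded_linear_bop_apply] bounded_linear_vec_nth)

lemma row_norm_nonneg: "0 \<le> row_norm X"
  unfolding row_norm_def by (rule onorm_pos_le[OF bounded_linear_row])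

lemma norm_row_power2_le:
  "(norm (\<Sum>i\<in>UNIV. bop_apply (X i) (h i)))\<^sup>2 \<le> (row_norm X)\<^sup>2 * (\<Sum>i\<in>UNIV. (norm (h i))\<^sup>2)"
proof -
  have "norm (\<Sum>i\<in>UNIV. bop_apply (X i) ((\<chi> i. h i) $ i)) \<le> row_norm X * norm (\<chi> i. h i)"
    unfolding row_norm_def by (rule onorm[OF bounded_linear_row])
  then have "(norm (\<Sum>i\<in>UNIV. bop_apply (X i) (h i)))\<^sup>2 \<le> (row_norm X * norm (\<chi> i. h i))\<^sup>2"
    by (intro power_mono) simp_all
  also have "\<dots> = (row_norm X)\<^sup>2 * (\<Sum>i\<in>UNIV. (norm (h i))\<^sup>2)"
    by (simp add: power_mult_distrib norm_vec_def L2_set_def sum_nonneg)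
  finally show ?thesis .
qed

lemma finite_words: "finite {\<alpha> :: 'n::finite list. length \<alpha> = k}"
  using finite_lists_length_eq[of "UNIV :: 'n set" k] by simp

lemma sum_words_Suc:
  fixes f :: "'n::finite list \<Rightarrow> 'b::comm_monoid_add"
  shows "(\<Sum>\<alpha> | length \<alpha> = Suc k. f \<alpha>) = (\<Sum>i\<in>UNIV. \<Sum>\<beta> | length \<beta> = k. f (i # \<beta>))"
proof -
  have "(\<Sum>\<alpha> | length \<alpha> = Suc k. f \<alpha>) = (\<Sum>(i, \<beta>)\<in>UNIV \<times> {\<beta>. length \<beta> = k}. f (i # \<beta>))"
    by (rule sum.reindex_bij_witness[of _ "\<lambda>(i, \<beta>). i # \<beta>" "\<lambda>\<alpha>. (hd \<alpha>, tl \<alpha>)"])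
      (auto simp: length_Suc_conv)
  then show ?thesis by (simp add: sum.cartesian_product)
qed

lemma word_op_Nil: "word_op X [] = 1" and word_op_Cons: "word_op X (i # \<alpha>) = X i * word_op X \<alpha>"
  by (simp_all add: word_op_def)

text \<open>Splitting off the first letter, the row of words of length \<open>Suc k\<close> is the
  row \<open>X\<close> applied to the outputs of rows of words of length \<open>k\<close>, so each
  letter costs one factor \<open>row_norm X\<close>.\<close>

lemma norm_word_row_power2_le:
  "(norm (\<Sum>\<alpha> | length \<alpha> = k. bop_apply (word_op X \<alpha>) (h \<alpha>)))\<^sup>2
    \<le> (row_norm X ^ k)\<^sup>2 * (\<Sum>\<alpha> | length \<alpha> = k. (norm (h \<alpha>))\<^sup>2)"
proof (induction k arbitrary: h)
  case 0
  then show ?case by (simp add: word_op_Nil one_bop.rep_eq)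
next
  case (Suc k)
  let ?g = "\<lambda>i. \<Sum>\<beta> | length \<beta> = k. bop_apply (word_op X \<beta>) (h (i # \<beta>))"
  have "(norm (\<Sum>\<alpha> | length \<alpha> = Suc k. bop_apply (word_op X \<alpha>) (h \<alpha>)))\<^sup>2
      = (norm (\<Sum>i\<in>UNIV. bop_apply (X i) (?g i)))\<^sup>2"
    by (simp only: sum_words_Suc word_op_Cons times_bop.rep_eq bop_apply_sum_right)
  also have "\<dots> \<le> (row_norm X)\<^sup>2 * (\<Sum>i\<in>UNIV. (norm (?g i))\<^sup>2)" by (rule norm_row_power2_le)
  also have "\<dots> \<le> (row_norm X)\<^sup>2 *
      (\<Sum>i\<in>UNIV. (row_norm X ^ k)\<^sup>2 * (\<Sum>\<beta> | length \<beta> = k. (norm (h (i # \<beta>)))\<^sup>2))"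
    by (intro mult_left_mono sum_mono Suc.IH) simp
  also have "\<dots> = (row_norm X ^ Suc k)\<^sup>2 * (\<Sum>\<alpha> | length \<alpha> = Suc k. (norm (h \<alpha>))\<^sup>2)"
    by (simp only: sum_words_Suc sum_distrib_left[symmetric] power_mult_distrib power_Suc mult.assoc)
  finally show ?case .
qed

lemma norm_homogeneous_part_le:
  "norm (homogeneous_part A X k)
    \<le> sqrt (norm (\<Sum>\<alpha> | length \<alpha> = k. adj (A \<alpha>) * A \<alpha>)) * row_norm X ^ k"
  unfolding homogeneous_part_def
proof (rule norm_sum_tensor_bop_le[OF finite_words])
  fix x
  show "(\<Sum>\<alpha> | length \<alpha> = k. (norm (bop_apply (A \<alpha>) x))\<^sup>2)
      \<le> (sqrt (norm (\<Sum>\<alpha> | length \<alpha> = k. adj (A \<alpha>) * A \<alpha>)))\<^sup>2 * (norm x)\<^sup>2"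
    using sum_norm_apply_power2_le[of A x "{\<alpha>. length \<alpha> = k}"] by simp
qed (simp_all add: row_norm_nonneg norm_word_row_power2_le)

section \<open>The root test\<close>

lemma powr_half_root_power:
  assumes "0 \<le> a" "0 < k"
  shows "(a powr (1 / (2 * real k))) ^ k = sqrt a"
proof (cases "a = 0")
  case False
  then have "(a powr (1 / (2 * real k))) ^ k = a powr (1 / (2 * real k) * real k)"
    using assms by (simp add: powr_powr flip: powr_realpow)
  also have "\<dots> = sqrt a" using assms by (simp add: powr_half_sqrt)
  finally show ?thesis .
qed (use assms in simp)

text \<open>Inverts a strict inequality across the whole of \<open>ennreal\<close>, where
  \<open>1 / 0 = top\<close> and \<open>1 / top = 0\<close> cover infinite and zero radius.\<close>

lemma less_inverse_ennreal_swap: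
  fixes a b :: ennreal
  assumes "a < 1 / b"
  shows "b < 1 / a"
proof (cases "a = 0 \<or> b = 0")
  case True
  then show ?thesis using assms
    by (auto simp: divide_ennreal_def less_top[symmetric] ennreal_inverse_positive)
next
  case False
  obtain r where r: "a = ennreal r" "0 \<le> r" using assms by (cases a) auto
  obtain s where s: "b = ennreal s" "0 \<le> s" using assms by (cases b) (auto simp: divide_ennreal_def)
  have pos: "0 < r" "0 < s" using False r s by (auto simp: less_le)
  have inv: "1 / ennreal x = ennreal (1 / x)" if "0 < x" for x
    using that by (simp add: divide_ennreal_def inverse_ennreal inverse_eq_divide)
  show ?thesis using assms pos
    by (simp add: r(1) s(1) inv ennreal_less_iff pos_less_divide_eq mult.commute)
qed

text \<open>A number \<open>c\<close> strictly between the limsup and \<open>1 / \<rho>\<close>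
  eventually dominates the roots, which leaves a geometric majorant of ratio
  \<open>c \<rho> < 1\<close>.\<close>

lemma summable_within_radius:
  fixes a :: "nat \<Rightarrow> real"
  assumes a: "\<And>k. 0 \<le> a k" and \<rho>: "0 \<le> \<rho>"
    and less: "ennreal \<rho> < 1 / limsup (\<lambda>k. ennreal (a k powr (1 / (2 * real k))))"
  shows "summable (\<lambda>k. sqrt (a k) * \<rho> ^ k)"
proof (cases "\<rho> = 0")
  \<comment> \<open>Only the term for \<open>k = 0\<close> survives, since
    \<open>0 ^ 0 = 1\<close>.\<close>
  case True
  then show ?thesis by (intro summable_finite[of "{0}"]) auto
next
  case False
  with \<rho> have pos: "\<rho> > 0" by simp
  have "limsup (\<lambda>k. ennreal (a k powr (1 / (2 * real k)))) < ennreal (1 / \<rho>)"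
    using less_inverse_ennreal_swap[OF less] pos
    by (simp add: divide_ennreal_def inverse_ennreal inverse_eq_divide)
  then obtain q where q: "limsup (\<lambda>k. ennreal (a k powr (1 / (2 * real k)))) < q" "q < ennreal (1 / \<rho>)"
    using dense by blast
  define c where "c = enn2real q"
  have c: "q = ennreal c" "0 \<le> c" using q(2) by (auto simp: c_def intro!: ennreal_enn2real[symmetric] order_less_trans[OF q(2)])
  have c\<rho>: "c * \<rho> < 1" using q(2) pos c by (simp add: ennreal_less_iff field_simps)
  have "\<forall>\<^sub>F k in sequentially. ennreal (a k powr (1 / (2 * real k))) < ennreal c"
    using q(1) unfolding c by (rule Limsup_lessD)
  then have "\<forall>\<^sub>F k in sequentially. norm (sqrt (a k) * \<rho> ^ k) \<le> (c * \<rho>) ^ k"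
    \<comment> \<open>At \<open>k = 0\<close> the exponent is \<open>1 / 0 = 0\<close>, and the
      \<open>k\<close>-th power does not recover \<open>sqrt (a k)\<close>.\<close>
    using eventually_gt_at_top[of 0]
  proof eventually_elim
    case (elim k)
    then have "a k powr (1 / (2 * real k)) \<le> c" by (simp add: ennreal_less_iff)
    then have "(a k powr (1 / (2 * real k))) ^ k \<le> c ^ k" by (intro power_mono) simp_all
    then have "sqrt (a k) \<le> c ^ k" using elim a by (simp add: powr_half_root_power)
    then show ?case using a \<rho> by (simp add: abs_mult power_mult_distrib mult_right_mono)
  qed
  then show ?thesis
    by (rule summable_comparison_test_ev) (use c\<rho> c \<rho> in \<open>simp add: summable_geometric\<close>)
qed

text \<open>The majorant \<open>sqrt (a k) * \<rho> ^ k\<close> depends on \<open>X\<close> only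
  through the bound on its row norm, so the Weierstrass test gives uniformity.\<close>

lemma converges_inside_radius:
  "converges_inside TYPE('h::chilbert_space) A (radius_of_convergence A)"
proof -
  define a where "a k = norm (\<Sum>\<alpha> | length \<alpha> = k. adj (A \<alpha>) * A \<alpha>)" for k
  have summable: "summable (\<lambda>k. sqrt (a k) * \<rho> ^ k)"
    if "0 \<le> \<rho>" "ennreal \<rho> < radius_of_convergence A" for \<rho>
    using that by (intro summable_within_radius) (simp_all add: radius_of_convergence_def a_def)
  have "summable (\<lambda>k. norm (homogeneous_part A X k))"
    if "ennreal (row_norm X) < radius_of_convergence A" for X :: "'a \<Rightarrow> 'h bop"
    using summable[OF row_norm_nonneg that] norm_homogeneous_part_le[of A X]
    by (intro summable_comparison_test[OF _ summable[OF row_norm_nonneg that]])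
      (auto simp: a_def)
  moreover have "uniformly_convergent_on {X :: 'a \<Rightarrow> 'h bop. row_norm X \<le> \<rho>}
      (\<lambda>N X. \<Sum>k<N. norm (homogeneous_part A X k))"
    if "0 \<le> \<rho>" "ennreal \<rho> < radius_of_convergence A" for \<rho>
  proof (rule Weierstrass_m_test'[OF _ summable[OF that]])
    fix k and X :: "'a \<Rightarrow> 'h bop" assume "X \<in> {X. row_norm X \<le> \<rho>}"
    then have "sqrt (a k) * row_norm X ^ k \<le> sqrt (a k) * \<rho> ^ k"
      by (intro mult_left_mono power_mono) (simp_all add: row_norm_nonneg a_def)
    then show "norm (norm (homogeneous_part A X k)) \<le> sqrt (a k) * \<rho> ^ k"
      using norm_homogeneous_part_le[of A X k] by (simp add: a_def)
  qed
  ultimately show ?thesis unfolding converges_inside_def by blast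
qed

section \<open>Left creation operators and divergence outside\<close>

text \<open>Gives access to the Cauchy criterion and to absolute convergence for series of
  vectors.\<close>

instance chilbert_space \<subseteq> banach ..

section \<open>Orthonormal sequences and partial isometries\<close>

definition orthonormal :: "('i \<Rightarrow> 'a::complex_inner) \<Rightarrow> bool" where
  "orthonormal e \<longleftrightarrow> (\<forall>i j. cinner (e i) (e j) = (if i = j then 1 else 0))"

lemma orthonormalD: "orthonormal e \<Longrightarrow> cinner (e i) (e j) = (if i = j then 1 else 0)"
  by (simp add: orthonormal_def)

lemma orthonormal_comp: "orthonormal e \<Longrightarrow> inj g \<Longrightarrow> orthonormal (\<lambda>i. e (g i))"
  by (simp add: orthonormal_def inj_eq)

lemma orthonormal_norm: "orthonormal e \<Longrightarrow> norm (e i) = 1"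
  by (simp add: norm_eq_sqrt_cinner orthonormal_def)

text \<open>Gram-Schmidt by recursion: the span of the finitely many earlier vectors is never the
  whole space, and the normalised residual of a vector outside it comes next.\<close>

lemma ex_orthonormal_sequence:
  assumes "infinite_dimensional TYPE('a::complex_inner)"
  shows "\<exists>e :: nat \<Rightarrow> 'a. orthonormal e"
proof -
  define P where "P f n r \<longleftrightarrow> cinner r r = 1 \<and> (\<forall>m<n. cinner (f m) r = 0)"
    for f :: "nat \<Rightarrow> 'a" and n r
  have "\<exists>f. \<forall>n. P f n (f n)"
  proof (rule dependent_wellorder_choice)
    show "P f n r = P g n r" if "\<And>y. y < n \<Longrightarrow> f y = g y" for r f g n
      using that by (simp add: P_def)
    show "\<exists>r. P f n r" if f: "\<And>y. y < n \<Longrightarrow> P f y (f y)" for n f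
    proof -
      \<comment> \<open>\<open>P\<close> records orthogonality to earlier vectors only; conjugate
        symmetry supplies the other order.\<close>
      have on: "cinner (f i) (f j) = (if i = j then 1 else 0)" if "i < n" "j < n" for i j
        using f[OF that(1)] f[OF that(2)] cinner_commute[of "f i" "f j"]
        by (cases i j rule: linorder_cases) (auto simp: P_def)
      obtain v where v: "v \<notin> cspan (f ` {..<n})"
        using assms unfolding infinite_dimensional_def by blast
      define w where "w = v - (\<Sum>m<n. cinner v (f m) *\<^sub>C f m)"
      have "(\<Sum>m<n. cinner v (f m) *\<^sub>C f m) \<in> cspan (f ` {..<n})"
        by (intro complex_vector.span_sum complex_vector.span_scale complex_vector.span_base) auto
      then have "w \<noteq> 0" using v by (auto simp: w_def)
      have "cinner (\<Sum>m<n. cinner v (f m) *\<^sub>C f m) (f j) = cinner v (f j)" if "j < n" for j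
      proof -
        have "cinner (\<Sum>m<n. cinner v (f m) *\<^sub>C f m) (f j) = (\<Sum>m<n. cinner v (f m) * cinner (f m) (f j))"
          by (simp add: cinner_sum_left cinner_scaleC_left)
        also have "\<dots> = (\<Sum>m<n. if m = j then cinner v (f m) else 0)"
          using that by (intro sum.cong refl) (simp add: on)
        finally show ?thesis using that by simp
      qed
      then have "cinner w (f j) = 0" if "j < n" for j
        using that by (simp add: w_def cinner_diff_left)
      then have orth: "cinner (f j) w = 0" if "j < n" for j
        using that cinner_commute[of "f j" w] by simp
      have "cinner (complex_of_real (1 / norm w) *\<^sub>C w) (complex_of_real (1 / norm w) *\<^sub>C w)
          = complex_of_real (1 / norm w) * (complex_of_real (1 / norm w) * complex_of_real ((norm w)\<^sup>2))"
        by (simp only: cinner_scaleC_left cinner_scaleC_right) (simp add: cinner_self)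
      also have "\<dots> = complex_of_real (1 / norm w * (1 / norm w * (norm w)\<^sup>2))"
        by (simp only: of_real_mult)
      also have "\<dots> = 1" using \<open>w \<noteq> 0\<close> by (simp add: power2_eq_square)
      finally have "P f n (complex_of_real (1 / norm w) *\<^sub>C w)"
        by (simp add: P_def orth cinner_scaleC_right)
      then show ?thesis by blast
    qed
  qed
  then obtain f where f: "\<And>n. P f n (f n)" by blast
  have "cinner (f i) (f j) = (if i = j then 1 else 0)" for i j
    using f[of i] f[of j] cinner_commute[of "f i" "f j"]
    by (cases i j rule: linorder_cases) (auto simp: P_def)
  then show ?thesis unfolding orthonormal_def by blast
qed

lemma bounded_linear_scaleC: "bounded_linear (\<lambda>x :: 'a::complex_inner. c *\<^sub>C x)"
  by (rule bounded_linear_intro[where K = "cmod c"])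
    (simp_all add: scaleC_add_right scaleR_scaleC scaleC_scaleC norm_scaleC mult.commute)

lemma summable_bessel:
  assumes "orthonormal (e :: nat \<Rightarrow> 'a::complex_inner)"
  shows "summable (\<lambda>n. (cmod (cinner h (e n)))\<^sup>2)"
proof (rule bounded_imp_summable)
  show "(\<Sum>k\<le>n. (cmod (cinner h (e k)))\<^sup>2) \<le> (norm h)\<^sup>2" for n
    by (rule bessel_inequality) (simp_all add: orthonormalD[OF assms])
qed simp

text \<open>By Pythagoras the blocks of the series have the same squared norms as the blocks of the
  coefficient series, so the Cauchy criterion transfers.\<close>

lemma summable_orthonormal_series:
  fixes f :: "nat \<Rightarrow> 'a::chilbert_space"
  assumes f: "orthonormal f" and c: "summable (\<lambda>n. (cmod (c n))\<^sup>2)"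
  shows "summable (\<lambda>n. c n *\<^sub>C f n)"
  unfolding summable_Cauchy
proof (intro allI impI)
  fix e :: real assume e: "e > 0"
  then obtain N where N: "\<And>m n. m \<ge> N \<Longrightarrow> norm (\<Sum>k=m..<n. (cmod (c k))\<^sup>2) < e\<^sup>2"
    using c unfolding summable_Cauchy by (meson zero_less_power)
  have "norm (\<Sum>k=m..<n. c k *\<^sub>C f k) < e" if "m \<ge> N" for m n
  proof -
    have "(norm (\<Sum>k=m..<n. c k *\<^sub>C f k))\<^sup>2 = (\<Sum>k=m..<n. (cmod (c k))\<^sup>2)"
      by (rule norm_power2_sum_orthonormal) (simp_all add: orthonormalD[OF f])
    also have "\<dots> < e\<^sup>2" using N[OF that, of n] by simp
    finally show ?thesis using e by (simp add: power2_less_imp_less)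
  qed
  then show "\<exists>N. \<forall>m\<ge>N. \<forall>n. norm (\<Sum>k=m..<n. c k *\<^sub>C f k) < e" by blast
qed

text \<open>For orthonormal \<open>e\<close> and \<open>f\<close> this sends \<open>e n\<close> to
  \<open>f n\<close> and vanishes on the orthogonal complement of the \<open>e n\<close>.\<close>

definition partial_isometry :: "(nat \<Rightarrow> 'h::chilbert_space) \<Rightarrow> (nat \<Rightarrow> 'h) \<Rightarrow> 'h bop" where
  "partial_isometry e f = Bop (\<lambda>h. \<Sum>n. cinner h (e n) *\<^sub>C f n)"

text \<open>Bessel for \<open>e\<close> makes the series converge and define a contraction, so
  \<open>Bop\<close> is applied to a genuine operator; the norm formula is Pythagoras for
  \<open>f\<close> in the limit.\<close>

lemma partial_isometry_sums:
  assumes e: "orthonormal e" and f: "orthonormal f"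
  shows "(\<lambda>n. cinner h (e n) *\<^sub>C f n) sums bop_apply (partial_isometry e f) h"
    and "(\<lambda>n. (cmod (cinner h (e n)))\<^sup>2) sums (norm (bop_apply (partial_isometry e f) h))\<^sup>2"
proof -
  define g where "g h = (\<Sum>n. cinner h (e n) *\<^sub>C f n)" for h
  have sm: "summable (\<lambda>n. cinner h (e n) *\<^sub>C f n)" for h
    by (intro summable_orthonormal_series summable_bessel e f)
  have g: "(\<lambda>n. cinner h (e n) *\<^sub>C f n) sums g h" for h
    unfolding g_def using sm by (rule summable_sums)
  have ng: "(\<lambda>n. (cmod (cinner h (e n)))\<^sup>2) sums (norm (g h))\<^sup>2" for h
  proof -
    have "(\<lambda>N. (norm (\<Sum>n<N. cinner h (e n) *\<^sub>C f n))\<^sup>2) \<longlonglongrightarrow> (norm (g h))\<^sup>2"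
      using g[of h] unfolding sums_def by (intro tendsto_intros)
    moreover have "(norm (\<Sum>n<N. cinner h (e n) *\<^sub>C f n))\<^sup>2 = (\<Sum>n<N. (cmod (cinner h (e n)))\<^sup>2)" for N
      by (rule norm_power2_sum_orthonormal) (simp_all add: orthonormalD[OF f])
    ultimately show ?thesis by (simp add: sums_def)
  qed
  have "\<exists>B. bop_apply B = g"
  proof (rule ex_bop)
    show "g (x + y) = g x + g y" for x y
      using sums_unique2[OF g[of "x + y"]] sums_add[OF g[of x] g[of y]]
      by (simp add: cinner_add_left scaleC_add_left)
    show "g (c *\<^sub>C x) = c *\<^sub>C g x" for c x
      using sums_unique2[OF g[of "c *\<^sub>C x"]] bounded_linear.sums[OF bounded_linear_scaleC g[of x], of c]
      by (simp add: cinner_scaleC_left scaleC_scaleC)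
    show "norm (g x) \<le> 1 * norm x" for x
    proof -
      have "(norm (g x))\<^sup>2 \<le> (norm x)\<^sup>2"
        using ng[of x] unfolding sums_def
        by (rule LIMSEQ_le_const2)
          (intro exI[of _ 0] allI impI bessel_inequality, simp_all add: orthonormalD[OF e])
      then show ?thesis by (simp add: power2_le_iff_abs_le)
    qed
  qed
  then obtain B where B: "bop_apply B = g" by blast
  have "partial_isometry e f = Bop g" by (simp add: partial_isometry_def g_def[abs_def])
  moreover have "Bop g = B" using bop_apply_inverse[of B] by (simp add: B)
  ultimately have "bop_apply (partial_isometry e f) = g" by (simp add: B)
  then show "(\<lambda>n. cinner h (e n) *\<^sub>C f n) sums bop_apply (partial_isometry e f) h"
    "(\<lambda>n. (cmod (cinner h (e n)))\<^sup>2) sums (norm (bop_apply (partial_isometry e f) h))\<^sup>2"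
    using g ng by simp_all
qed

lemma partial_isometry_apply:
  assumes e: "orthonormal e" and f: "orthonormal f"
  shows "bop_apply (partial_isometry e f) (e m) = f m"
proof -
  have "(\<lambda>n. cinner (e m) (e n) *\<^sub>C f n) = (\<lambda>n. if n = m then f n else 0)"
    by (auto simp: fun_eq_iff orthonormalD[OF e] scaleC_one)
  then have "(\<lambda>n. cinner (e m) (e n) *\<^sub>C f n) sums f m" using sums_single[of m f] by simp
  then show ?thesis using partial_isometry_sums(1)[OF e f] sums_unique2 by blast
qed

text \<open>Both sides of the adjoint relation expand into series that agree term by term.\<close>

lemma adj_partial_isometry:
  assumes e: "orthonormal e" and f: "orthonormal f"
  shows "adj (partial_isometry e f) = partial_isometry f e"
proof (rule adj_eqI)
  fix x y
  have "(\<lambda>n. cinner (cinner x (e n) *\<^sub>C f n) y) sums cinner (bop_apply (partial_isometry e f) x) y"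
    by (intro bounded_linear.sums[OF bounded_bilinear.bounded_linear_left[OF bounded_bilinear_cinner]]
        partial_isometry_sums e f)
  moreover have "(\<lambda>n. cinner x (cinner y (f n) *\<^sub>C e n)) sums cinner x (bop_apply (partial_isometry f e) y)"
    by (intro bounded_linear.sums[OF bounded_linear_cinner_right] partial_isometry_sums e f)
  moreover have "cinner (cinner x (e n) *\<^sub>C f n) y = cinner x (cinner y (f n) *\<^sub>C e n)" for n
    using cinner_commute[of "f n" y] by (simp add: cinner_scaleC_left cinner_scaleC_right)
  ultimately show "cinner (bop_apply (partial_isometry e f) x) y
      = cinner x (bop_apply (partial_isometry f e) y)"
    using sums_unique2 by simp
qed

lemma adj_scaleR: "adj (r *\<^sub>R A) = r *\<^sub>R adj A"
  by (rule adj_eqI)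
    (simp add: scaleR_bop.rep_eq scaleR_scaleC cinner_scaleC_left cinner_scaleC_right cinner_adj)

text \<open>Words with different first letters are different, so the \<open>W i\<close> have
  mutually orthogonal ranges and the sum is the projection onto the vectors of nonempty
  words.\<close>

lemma ex_left_creation_operators:
  assumes "infinite_dimensional TYPE('h::chilbert_space)"
  shows "\<exists>(E :: 'n::finite list \<Rightarrow> 'h) W. orthonormal E \<and>
    (\<forall>i \<alpha>. bop_apply (W i) (E \<alpha>) = E (i # \<alpha>)) \<and> norm (\<Sum>i\<in>UNIV. W i * adj (W i)) = 1"
proof -
  obtain e :: "nat \<Rightarrow> 'h" where e: "orthonormal e" using ex_orthonormal_sequence[OF assms] by blast
  define E :: "'n list \<Rightarrow> 'h" where "E \<alpha> = e (to_nat \<alpha>)" for \<alpha>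
  have E: "orthonormal E" unfolding E_def by (intro orthonormal_comp[OF e] inj_to_nat)
  \<comment> \<open>An enumeration of all words, because \<open>partial_isometry\<close> is indexed
    by \<open>nat\<close>.\<close>
  define b :: "nat \<Rightarrow> 'n list" where "b = from_nat_into UNIV"
  have "bij b" unfolding b_def
    by (intro bij_betw_from_nat_into countableI_type infinite_UNIV_listI)
  then have inj_b: "inj b" and surj_b: "\<exists>n. \<alpha> = b n" for \<alpha>
    by (auto simp: bij_def surj_def)
  have Eb: "orthonormal (\<lambda>n. E (b n))" by (rule orthonormal_comp[OF E inj_b])
  have Ei: "orthonormal (\<lambda>n. E (i # b n))" for i
    using orthonormal_comp[OF E, of "\<lambda>n. i # b n"] inj_b by (simp add: inj_def)
  define W where "W i = partial_isometry (\<lambda>n. E (b n)) (\<lambda>n. E (i # b n))" for i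
  have W: "bop_apply (W i) (E \<alpha>) = E (i # \<alpha>)" for i \<alpha>
    using surj_b[of \<alpha>] partial_isometry_apply[OF Eb Ei] by (auto simp: W_def)
  have adjW: "adj (W i) = partial_isometry (\<lambda>n. E (i # b n)) (\<lambda>n. E (b n))" for i
    unfolding W_def by (rule adj_partial_isometry[OF Eb Ei])
  have eq: "(\<Sum>i\<in>UNIV. W i * adj (W i)) = (\<Sum>i\<in>UNIV. adj (adj (W i)) * adj (W i))"
    by (simp only: adj_adj)
  have "norm (\<Sum>i\<in>UNIV. W i * adj (W i)) \<le> 1"
    unfolding eq
  proof (rule norm_sum_adj_mult_le)
    fix x
    have "(\<lambda>n. \<Sum>i\<in>UNIV. (cmod (cinner x (E (i # b n))))\<^sup>2) sums
        (\<Sum>i\<in>UNIV. (norm (bop_apply (adj (W i)) x))\<^sup>2)"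
      unfolding adjW by (intro sums_sum partial_isometry_sums Ei Eb)
    \<comment> \<open>The pairs \<open>(n, i)\<close> give distinct words \<open>i # b n\<close>, so
      Bessel applies to each finite rectangle before \<open>N\<close> goes to infinity.\<close>
    moreover have "(\<Sum>n<N. \<Sum>i\<in>UNIV. (cmod (cinner x (E (i # b n))))\<^sup>2) \<le> (norm x)\<^sup>2" for N
    proof -
      have "(\<Sum>p\<in>{..<N} \<times> UNIV. (cmod (cinner x (E (snd p # b (fst p)))))\<^sup>2) \<le> (norm x)\<^sup>2"
        using inj_b by (intro bessel_inequality) (auto simp: orthonormalD[OF E] inj_eq)
      then show ?thesis by (simp add: sum.cartesian_product split_def)
    qed
    ultimately show "(\<Sum>i\<in>UNIV. (norm (bop_apply (adj (W i)) x))\<^sup>2) \<le> 1 * (norm x)\<^sup>2"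
      unfolding sums_def by (auto intro: LIMSEQ_le_const2)
  qed simp
  moreover have "1 \<le> norm (\<Sum>i\<in>UNIV. W i * adj (W i))"
  proof -
    \<comment> \<open>Any letter will do, and one exists as types are nonempty; the norm
      \<open>1\<close> is attained at \<open>E [j]\<close>.\<close>
    fix j :: 'n
    obtain n where n: "[] = b n" using surj_b by blast
    have "bop_apply (adj (W j)) (E [j]) = E []"
      using partial_isometry_apply[OF Ei Eb, of j n] by (simp add: adjW n[symmetric])
    then have "1 = (norm (bop_apply (adj (W j)) (E [j])))\<^sup>2" by (simp add: orthonormal_norm[OF E])
    also have "\<dots> \<le> (\<Sum>i\<in>UNIV. (norm (bop_apply (adj (W i)) (E [j])))\<^sup>2)"
      by (rule member_le_sum) simp_all
    also have "\<dots> \<le> norm (\<Sum>i\<in>UNIV. adj (adj (W i)) * adj (W i)) * (norm (E [j]))\<^sup>2"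
      by (rule sum_norm_apply_power2_le)
    finally show ?thesis by (simp add: orthonormal_norm[OF E] adj_adj)
  qed
  ultimately have "norm (\<Sum>i\<in>UNIV. W i * adj (W i)) = 1" by simp
  then show ?thesis using E W by blast
qed

section \<open>The lower bound and divergence\<close>

lemma norm_power2_sum_tensor_orthonormal:
  assumes I: "finite I" and E: "orthonormal E"
  shows "(norm (\<Sum>i\<in>I. u i \<otimes> E i))\<^sup>2 = (\<Sum>i\<in>I. (norm (u i))\<^sup>2)"
proof -
  have "cinner (\<Sum>i\<in>I. u i \<otimes> E i) (\<Sum>i\<in>I. u i \<otimes> E i)
      = (\<Sum>i\<in>I. \<Sum>j\<in>I. cinner (u j) (u i) * cinner (E j) (E i))"
    by (simp add: cinner_sum_left cinner_sum_right cinner_tensor)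
  also have "\<dots> = (\<Sum>i\<in>I. \<Sum>j\<in>I. if j = i then cinner (u j) (u i) else 0)"
    by (intro sum.cong refl) (simp add: orthonormalD[OF E])
  also have "\<dots> = (\<Sum>i\<in>I. cinner (u i) (u i))" using I by simp
  finally show ?thesis unfolding norm_power2_cinner by simp
qed

text \<open>The words of length \<open>k\<close> send \<open>E []\<close> to \<open>r ^ k\<close>
  times distinct orthonormal vectors. Nothing cancels at \<open>x \<otimes> E []\<close>, so its
  image displays the whole column at \<open>x\<close>.\<close>

lemma sum_adj_mult_le_homogeneous_part:
  fixes A :: "'n::finite list \<Rightarrow> 'k::chilbert_space bop" and X :: "'n \<Rightarrow> 'h::chilbert_space bop"
  assumes E: "orthonormal E" and r: "0 < r"
    and X: "\<And>i \<alpha>. bop_apply (X i) (E \<alpha>) = r *\<^sub>R E (i # \<alpha>)"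
  shows "sqrt (norm (\<Sum>\<alpha> | length \<alpha> = k. adj (A \<alpha>) * A \<alpha>)) * r ^ k \<le> norm (homogeneous_part A X k)"
proof -
  define q where "q = norm (homogeneous_part A X k)"
  have word: "bop_apply (word_op X \<alpha>) (E []) = r ^ length \<alpha> *\<^sub>R E \<alpha>" for \<alpha>
  proof (induction \<alpha>)
    case Nil
    then show ?case by (simp add: word_op_Nil one_bop.rep_eq)
  next
    case (Cons i \<alpha>)
    then show ?case
      by (simp add: word_op_Cons times_bop.rep_eq X linear_simps[OF bounded_linear_bop_apply] mult.commute)
  qed
  have "norm (\<Sum>\<alpha> | length \<alpha> = k. adj (A \<alpha>) * A \<alpha>) \<le> (q / r ^ k)\<^sup>2"
  proof (rule norm_sum_adj_mult_le)
    fix x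
    have "bop_apply (homogeneous_part A X k) (x \<otimes> E [])
        = (\<Sum>\<alpha> | length \<alpha> = k. (complex_of_real (r ^ k) *\<^sub>C bop_apply (A \<alpha>) x) \<otimes> E \<alpha>)"
      by (simp add: homogeneous_part_def bop_apply_sum tensor_bop_tensor word scaleR_scaleC
          tensor_scaleC_left tensor_scaleC_right)
    then have "(norm (bop_apply (homogeneous_part A X k) (x \<otimes> E [])))\<^sup>2
        = (\<Sum>\<alpha> | length \<alpha> = k. (r ^ k)\<^sup>2 * (norm (bop_apply (A \<alpha>) x))\<^sup>2)"
      using r by (simp add: norm_power2_sum_tensor_orthonormal[OF finite_words E] norm_scaleC
          power_mult_distrib norm_power)
    moreover have "(norm (bop_apply (homogeneous_part A X k) (x \<otimes> E [])))\<^sup>2 \<le> (q * norm x)\<^sup>2"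
      using norm_bop_apply_le[of "homogeneous_part A X k" "x \<otimes> E []"]
      by (intro power_mono) (simp_all add: q_def norm_tensor orthonormal_norm[OF E])
    ultimately have "(r ^ k)\<^sup>2 * (\<Sum>\<alpha> | length \<alpha> = k. (norm (bop_apply (A \<alpha>) x))\<^sup>2) \<le> q\<^sup>2 * (norm x)\<^sup>2"
      by (simp add: sum_distrib_left power_mult_distrib)
    then show "(\<Sum>\<alpha> | length \<alpha> = k. (norm (bop_apply (A \<alpha>) x))\<^sup>2) \<le> (q / r ^ k)\<^sup>2 * (norm x)\<^sup>2"
      using r by (simp add: power_divide pos_le_divide_eq mult.commute)
  qed simp
  then have "sqrt (norm (\<Sum>\<alpha> | length \<alpha> = k. adj (A \<alpha>) * A \<alpha>)) \<le> q / r ^ k"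
    using r by (intro real_le_lsqrt) (simp_all add: q_def)
  then show ?thesis using r by (simp add: q_def pos_le_divide_eq)
qed

text \<open>The earlier swap applied to reciprocals, since inversion in \<open>ennreal\<close> is an
  involution.\<close>

lemma ennreal_less_inverse_swap:
  fixes a b :: ennreal
  assumes "1 / a < b"
  shows "1 / b < a"
proof -
  have "inverse (inverse x) = x" for x :: ennreal
  proof (cases x)
    case (real r)
    then show ?thesis by (cases "r = 0") (simp_all add: inverse_ennreal)
  qed simp
  then show ?thesis
    using less_inverse_ennreal_swap[of "1 / a" "1 / b"] assms by (simp add: divide_ennreal_def)
qed

lemma diverges_outside_radius:
  assumes "infinite_dimensional TYPE('h::chilbert_space)"
  shows "diverges_outside TYPE('h) A (radius_of_convergence A)"
  unfolding diverges_outside_def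
proof (intro allI impI)
  fix r :: real
  assume r: "radius_of_convergence A < ennreal r"
  \<comment> \<open>For \<open>r \<le> 0\<close> the value \<open>ennreal r\<close> is
    \<open>0\<close>, and nothing lies below it.\<close>
  then have pos: "r > 0" by (cases "r > 0") (auto simp: ennreal_neg)
  obtain E :: "'a list \<Rightarrow> 'h" and W where E: "orthonormal E"
    and W: "\<And>i \<alpha>. bop_apply (W i) (E \<alpha>) = E (i # \<alpha>)" and nW: "norm (\<Sum>i\<in>UNIV. W i * adj (W i)) = 1"
    using ex_left_creation_operators[OF assms, where 'n = 'a] by blast
  define X where "X i = r *\<^sub>R W i" for i
  have "(\<Sum>i\<in>UNIV. X i * adj (X i)) = r\<^sup>2 *\<^sub>R (\<Sum>i\<in>UNIV. W i * adj (W i))"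
    by (simp add: X_def adj_scaleR scaleR_sum_right power2_eq_square)
  then have norm_X: "sqrt (norm (\<Sum>i\<in>UNIV. X i * adj (X i))) = r" using pos by (simp add: nW)
  define a where "a k = norm (\<Sum>\<alpha> | length \<alpha> = k. adj (A \<alpha>) * A \<alpha>)" for k
  have lower: "sqrt (a k) * r ^ k \<le> norm (homogeneous_part A X k)" for k
    unfolding a_def by (rule sum_adj_mult_le_homogeneous_part[OF E pos]) (simp add: X_def scaleR_bop.rep_eq W)
  have L: "1 / ennreal r < limsup (\<lambda>k. ennreal (a k powr (1 / (2 * real k))))"
    by (rule ennreal_less_inverse_swap) (use r in \<open>simp add: radius_of_convergence_def a_def\<close>)
  have "\<not> summable (homogeneous_part A X)"
  proof
    assume "summable (homogeneous_part A X)"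
    then have "(\<lambda>k. norm (homogeneous_part A X k)) \<longlonglongrightarrow> 0"
      by (intro tendsto_norm_zero summable_LIMSEQ_zero)
    then have "\<forall>\<^sub>F k in sequentially. norm (homogeneous_part A X k) < 1"
      by (rule order_tendstoD) simp
    \<comment> \<open>Terms of norm below \<open>1\<close> force
      \<open>sqrt (a k) * r ^ k < 1\<close>; taking \<open>k\<close>-th roots bounds the limsup by
      \<open>1 / r\<close>, against \<open>L\<close>.\<close>
    then have "\<forall>\<^sub>F k in sequentially. ennreal (a k powr (1 / (2 * real k))) \<le> 1 / ennreal r"
      using eventually_gt_at_top[of 0]
    proof eventually_elim
      case (elim k)
      have "sqrt (a k) * r ^ k < 1" using lower[of k] elim by simp
      then have "(a k powr (1 / (2 * real k)) * r) ^ k < 1"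
        using elim by (simp add: power_mult_distrib powr_half_root_power a_def)
      then have "a k powr (1 / (2 * real k)) * r < 1"
        using power_less_imp_less_base[of "a k powr (1 / (2 * real k)) * r" k 1] by simp
      then have "a k powr (1 / (2 * real k)) \<le> 1 / r"
        using pos by (simp add: pos_le_divide_eq)
      moreover have "1 / ennreal r = ennreal (1 / r)"
        using pos by (simp add: divide_ennreal_def inverse_ennreal inverse_eq_divide)
      ultimately show ?case by (simp add: ennreal_leI)
    qed
    then have "limsup (\<lambda>k. ennreal (a k powr (1 / (2 * real k)))) \<le> 1 / ennreal r"
      by (rule Limsup_bounded)
    then show False using L by simp
  qed
  then show "\<exists>X :: 'a \<Rightarrow> 'h bop. sqrt (norm (\<Sum>i\<in>UNIV. X i * adj (X i))) = r \<and>
      \<not> summable (homogeneous_part A X)"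
    using norm_X by blast
qed

text \<open>Property (i) measures a tuple by \<open>row_norm\<close>, property (ii) by the sum of
  the \<open>X i * adj (X i)\<close>; this lets a tuple from (ii) enter (i). Pairing
  \<open>h\<close> with itself moves the \<open>X i\<close> across as adjoints, to which the column
  bound applies.\<close>

lemma row_norm_le:
  fixes X :: "'n::finite \<Rightarrow> 'h::chilbert_space bop"
  shows "row_norm X \<le> sqrt (norm (\<Sum>i\<in>UNIV. X i * adj (X i)))"
  unfolding row_norm_def
proof (rule onorm_bound)
  fix v :: "'h ^ 'n"
  define N where "N = norm (\<Sum>i\<in>UNIV. X i * adj (X i))"
  define h where "h = (\<Sum>i\<in>UNIV. bop_apply (X i) (v $ i))"
  have "norm h * norm h = cmod (cinner h h)" by (simp add: cinner_self power2_eq_square norm_mult)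
  also have "\<dots> = cmod (\<Sum>i\<in>UNIV. cinner (v $ i) (bop_apply (adj (X i)) h))"
    by (subst h_def) (simp only: cinner_sum_left cinner_adj)
  also have "\<dots> \<le> (\<Sum>i\<in>UNIV. \<bar>norm (v $ i)\<bar> * \<bar>norm (bop_apply (adj (X i)) h)\<bar>)"
    by (rule sum_norm_le) (simp add: cmod_cinner_le)
  also have "\<dots> \<le> L2_set (\<lambda>i. norm (v $ i)) UNIV * L2_set (\<lambda>i. norm (bop_apply (adj (X i)) h)) UNIV"
    by (rule L2_set_mult_ineq)
  also have "\<dots> \<le> L2_set (\<lambda>i. norm (v $ i)) UNIV * (sqrt N * norm h)"
  proof (rule mult_left_mono)
    have "(\<Sum>i\<in>UNIV. (norm (bop_apply (adj (X i)) h))\<^sup>2) \<le> N * (norm h)\<^sup>2"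
      using sum_norm_apply_power2_le[of "\<lambda>i. adj (X i)" h UNIV] by (simp add: adj_adj N_def)
    then show "L2_set (\<lambda>i. norm (bop_apply (adj (X i)) h)) UNIV \<le> sqrt N * norm h"
      using real_sqrt_le_mono by (fastforce simp: L2_set_def real_sqrt_mult)
  qed (rule L2_set_nonneg)
  also have "L2_set (\<lambda>i. norm (v $ i)) UNIV = norm v" by (simp add: norm_vec_def)
  finally have "norm h * norm h \<le> sqrt N * norm v * norm h" by (simp only: mult_ac)
  then have "norm h \<le> sqrt N * norm v" by (rule norm_le_from_square) (simp_all add: N_def)
  then show "norm (\<Sum>i\<in>UNIV. bop_apply (X i) (v $ i))
      \<le> sqrt (norm (\<Sum>i\<in>UNIV. X i * adj (X i))) * norm v"
    by (simp only: h_def N_def)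
qed simp

text \<open>Links the convergence of norms in (i) with the operator series in (ii). The series is
  summed pointwise, and the tail of the norms bounds the error uniformly on vectors.\<close>

lemma bop_summable_norm_cancel:
  fixes T :: "nat \<Rightarrow> 'a::chilbert_space bop"
  assumes T: "summable (\<lambda>k. norm (T k))"
  shows "summable T"
proof -
  define g where "g x = (\<Sum>k. bop_apply (T k) x)" for x
  have le: "norm (bop_apply (T k) x) \<le> norm (T k) * norm x" for k x by (rule norm_bop_apply_le)
  have smn: "summable (\<lambda>k. norm (T (k + N)) * norm x)" for N x
    by (intro summable_mult2 summable_ignore_initial_segment T)
  have smx: "summable (\<lambda>k. norm (bop_apply (T (k + N)) x))" for N x
    by (rule summable_comparison_test[OF _ smn[of N x]]) (simp add: le)
  \<comment> \<open>At \<open>N = 0\<close> this bounds the pointwise limit \<open>g\<close>; for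
    general \<open>N\<close> it gives the rate of convergence in operator norm.\<close>
  have tail: "norm (\<Sum>k. bop_apply (T (k + N)) x) \<le> (\<Sum>k. norm (T (k + N))) * norm x" for N x
  proof -
    have "norm (\<Sum>k. bop_apply (T (k + N)) x) \<le> (\<Sum>k. norm (bop_apply (T (k + N)) x))"
      by (rule summable_norm[OF smx])
    also have "\<dots> \<le> (\<Sum>k. norm (T (k + N)) * norm x)" by (rule suminf_le[OF le smx smn])
    also have "\<dots> = (\<Sum>k. norm (T (k + N))) * norm x"
      by (intro suminf_mult2[symmetric] summable_ignore_initial_segment T)
    finally show ?thesis .
  qed
  have sm: "summable (\<lambda>k. bop_apply (T k) x)" for x
    using smx[of 0 x] by (simp add: summable_norm_cancel)
  have "\<exists>B. bop_apply B = g"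
  proof (rule ex_bop)
    show "g (x + y) = g x + g y" for x y by (simp add: g_def bop_apply_add suminf_add[OF sm sm])
    show "g (c *\<^sub>C x) = c *\<^sub>C g x" for c x
      by (simp add: g_def bop_apply_scaleC bounded_linear.suminf[OF bounded_linear_scaleC sm])
    show "norm (g x) \<le> (\<Sum>k. norm (T k)) * norm x" for x using tail[of 0 x] by (simp add: g_def)
  qed
  then obtain B where B: "bop_apply B = g" by blast
  have "norm (B - (\<Sum>k<N. T k)) \<le> (\<Sum>k. norm (T (k + N)))" for N
  proof (rule norm_bop_le)
    show "0 \<le> (\<Sum>k. norm (T (k + N)))" by (intro suminf_nonneg summable_ignore_initial_segment T) simp
    fix x
    have "bop_apply (B - (\<Sum>k<N. T k)) x = (\<Sum>k. bop_apply (T (k + N)) x)"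
      by (simp add: minus_bop.rep_eq B bop_apply_sum g_def suminf_minus_initial_segment[OF sm])
    then show "norm (bop_apply (B - (\<Sum>k<N. T k)) x) \<le> (\<Sum>k. norm (T (k + N))) * norm x"
      using tail by simp
  qed
  moreover have "(\<lambda>N. \<Sum>k. norm (T (k + N))) \<longlonglongrightarrow> 0"
  proof -
    have "(\<lambda>N. (\<Sum>k. norm (T k)) - (\<Sum>k<N. norm (T k))) \<longlonglongrightarrow> (\<Sum>k. norm (T k)) - (\<Sum>k. norm (T k))"
      by (intro tendsto_intros summable_LIMSEQ T)
    then show ?thesis by (simp add: suminf_minus_initial_segment[OF T])
  qed
  ultimately have "(\<lambda>N. B - (\<Sum>k<N. T k)) \<longlonglongrightarrow> 0"
    by (rule Lim_null_comparison[OF always_eventually[OF allI]])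
  then have "(\<lambda>N. B - (B - (\<Sum>k<N. T k))) \<longlonglongrightarrow> B - 0" by (intro tendsto_intros)
  then show ?thesis unfolding summable_def sums_def by auto
qed

section \<open>Uniqueness of the radius\<close>

lemma converges_inside_le_diverges_outside:
  assumes conv: "converges_inside TYPE('h::chilbert_space) A S"
    and div: "diverges_outside TYPE('h) A R"
  shows "S \<le> R"
proof (rule ccontr)
  assume "\<not> S \<le> R"
  then obtain q where q: "R < q" "q < S" using dense[of R S] by (auto simp: not_le)
  \<comment> \<open>(ii) takes a real \<open>R'\<close>, so the intermediate value has to be
    finite.\<close>
  have "q < top" using q(2) by (rule order.strict_trans2) simp
  then have c: "q = ennreal (enn2real q)" by simp
  then obtain X :: "'a \<Rightarrow> 'h bop"
    where X: "sqrt (norm (\<Sum>i\<in>UNIV. X i * adj (X i))) = enn2real q" "\<not> summable (homogeneous_part A X)"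
    using div q(1) unfolding diverges_outside_def by metis
  have "ennreal (row_norm X) \<le> q"
    using row_norm_le[of X] by (subst c) (simp add: X(1) ennreal_leI)
  then have "summable (\<lambda>k. norm (homogeneous_part A X k))"
    using conv q(2) unfolding converges_inside_def by (meson order.strict_trans1)
  then show False using X(2) bop_summable_norm_cancel by blast
qed

theorem theorem1p1:
  fixes A :: "'n::finite list \<Rightarrow> 'k::chilbert_space bop"
    and R :: ennreal
  assumes R_def: "R = radius_of_convergence A"
  shows "converges_inside TYPE('h::chilbert_space) A R \<and>
    (infinite_dimensional TYPE('h) \<longrightarrow>
      diverges_outside TYPE('h) A R \<and>
      (\<forall>S. converges_inside TYPE('h) A S \<and> diverges_outside TYPE('h) A S \<longrightarrow> S = R))"
proof (intro conjI impI allI)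
  show conv: "converges_inside TYPE('h) A R"
    unfolding R_def by (rule converges_inside_radius)
  assume inf: "infinite_dimensional TYPE('h)"
  show div: "diverges_outside TYPE('h) A R"
    unfolding R_def by (rule diverges_outside_radius[OF inf])
  fix S assume "converges_inside TYPE('h) A S \<and> diverges_outside TYPE('h) A S"
  \<comment> \<open>Both numbers have both properties, so the comparison applies in either
    order.\<close>
  then show "S = R"
    using converges_inside_le_diverges_outside[of A S R] converges_inside_le_diverges_outside[of A R S]
      conv div by (intro antisym) blast+
qed

end
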